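(* Let $q: Y \to X$ be a quotient map from a standard space $Y$ to a Hausdorff space $X$. Then the following are equivalent: (i) $X$ has a sequentially dense subset $E$ such that each $x\in E$ is a point of compact type of $X$, and $X$ and $E$ have properties (a) and (b): Property (a). Whenever $(x_m)$ is a sequence of distinct points in $E$ with limit $x_0\in X$, there is a subsequence $(x_n)$ such that for all sequences $(x_n^j)_j$ in $X$ with $x_n^j\to x_n$ as $j\to\infty$ (for each $n$) there exist natural numbers $k_n$ $(n\ge 1)$ such that the set $\{ x_n^j: n\ge 1, j\ge k_n\}$ has compact closure in $X$. Property (b). Whenever $(x_m)$ is a sequence of distinct points in $X$ with limit $x_0\in X$, there is a subsequence $(x_n)$ and sequences $(x_n^j)_j$ in $E$ with $x_n^j\to x_n$ as $j\to\infty$ (for each $n$) such that every diagonal sequence from the set $\{ x_n^j: n, j\ge 1\}$ converges to $x_0$. (ii) The map $q_*|V: V\to X$ is an irreducible quotient map from $V$ onto $X$, where $V$ is the closure in $Y_*$ of the set of singleton fibres of $Y_*$.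
   Context: A standard space is a locally compact separable metric space. A surjective map $r:Z\to X$ is irreducible if $Z$ has no proper closed subset $W$ with $r(W)=X$. $\mathrm{Cl}(Y)$ denotes the set of all closed subsets of $Y$ with the Fell topology, which has as subbase the sets $\{F: F\cap K=\emptyset\}$ ($K\subseteq Y$ compact) and $\{F: F\cap U\neq\emptyset\}$ ($U\subseteq Y$ open). The fibres of $q$ (fibres of $Y$) are the sets $q^{-1}(x)$, $x\in X$. $Y_*$ is the set of non-empty members of the closure in $\mathrm{Cl}(Y)$ of the set of fibres, with the relative Fell topology. The map $q$ is constant on each $F\in Y_*$, and $q_*:Y_*\to X$ is defined by $q_*(F)=q(y)$ for $y\in F$; it is known that $Y_*$ is a standard space and $q_*$ is a quotient map. The set of singleton fibres of $Y_*$ is $\{z\in Y_*: q_*^{-1}(q_*(z))=\{z\}\}$. A point $x\in X$ is of compact type if there is a compact subset $K\subseteq X$ such that whenever $(x_n)$ is a sequence in $X$ converging to $x$, eventually $x_n$ belongs to $K$. A subset $E\subseteq X$ is sequentially dense if every point of $X$ is the limit of a sequence of points of $E$. A diagonal sequence from $\{x_n^j: n,j\ge 1\}$ is a sequence of the form $(x_n^{j_n})_{n\ge 1}$ with $j_n\ge 1$. *)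

theory Defs
  imports "HOL-Analysis.Analysis"
begin

(* "Metric space" is taken up to the choice of a compatible metric. *)
definition standard_space :: "'a topology \<Rightarrow> bool" where
  "standard_space X \<longleftrightarrow>
     metrizable_space X \<and> locally_compact_space X \<and> separable_space X"

definition irreducible_map :: "'a topology \<Rightarrow> 'b topology \<Rightarrow> ('a \<Rightarrow> 'b) \<Rightarrow> bool" where
  "irreducible_map Z X r \<longleftrightarrow>
     r ` topspace Z = topspace X \<and>
     \<not> (\<exists>W. closedin Z W \<and> W \<noteq> topspace Z \<and> r ` W = topspace X)"

definition fell_topology :: "'a topology \<Rightarrow> 'a set topology" where
  "fell_topology Y = topology_generated_by
     ({{F. closedin Y F \<and> F \<inter> K = {}} | K. compactin Y K} \<union>
      {{F. closedin Y F \<and> F \<inter> U \<noteq> {}} | U. openin Y U})"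

lemma topspace_fell_topology: "topspace (fell_topology Y) = {F. closedin Y F}"
proof -
  have "{F. closedin Y F} \<in> {{F. closedin Y F \<and> F \<inter> K = {}} | K. compactin Y K}"
    by (rule CollectI, rule exI[of _ "{}"]) auto
  then show ?thesis
    unfolding fell_topology_def topology_generated_by_topspace by auto
qed

definition fibres :: "'a topology \<Rightarrow> 'b topology \<Rightarrow> ('a \<Rightarrow> 'b) \<Rightarrow> 'a set set" where
  "fibres Y X q = {{y \<in> topspace Y. q y = x} | x. x \<in> topspace X}"

definition Y_star :: "'a topology \<Rightarrow> 'b topology \<Rightarrow> ('a \<Rightarrow> 'b) \<Rightarrow> 'a set topology" where
  "Y_star Y X q =
     subtopology (fell_topology Y) ((fell_topology Y closure_of fibres Y X q) - {{}})"

(* Meaningful only when q is constant on the non-empty set F; for F in Y_star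
   this is the lemma q_star_eq below. *)
definition q_star :: "('a \<Rightarrow> 'b) \<Rightarrow> 'a set \<Rightarrow> 'b" where
  "q_star q F = the_elem (q ` F)"

lemma q_star_eq:
  assumes q: "quotient_map Y X q" and X: "Hausdorff_space X"
    and F: "F \<in> topspace (Y_star Y X q)" and y: "y \<in> F"
  shows "q_star q F = q y"
proof -
  have cl: "F \<in> fell_topology Y closure_of fibres Y X q"
    using F by (auto simp: Y_star_def)
  then have "closedin Y F"
    by (simp add: in_closure_of topspace_fell_topology)
  then have FY: "F \<subseteq> topspace Y"
    by (rule closedin_subset)
  have cont: "continuous_map Y X q"
    by (rule quotient_imp_continuous_map[OF q])
  have const: "q z = q y" if z: "z \<in> F" for z
  proof (rule ccontr)
    assume ne: "q z \<noteq> q y"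
    have "q z \<in> topspace X" "q y \<in> topspace X"
      using y z FY cont by (auto simp: continuous_map_def)
    then obtain U V where UV: "openin X U" "openin X V" "q z \<in> U" "q y \<in> V" "disjnt U V"
      using X ne unfolding Hausdorff_space_def by blast
    define A where "A = {a \<in> topspace Y. q a \<in> U}"
    define B where "B = {a \<in> topspace Y. q a \<in> V}"
    have AB: "openin Y A" "openin Y B"
      unfolding A_def B_def
      by (rule openin_continuous_map_preimage[OF cont UV(1)],
          rule openin_continuous_map_preimage[OF cont UV(2)])
    have sub: "openin (fell_topology Y) {F. closedin Y F \<and> F \<inter> O' \<noteq> {}}"
      if "openin Y O'" for O'
      unfolding fell_topology_def using that by (intro topology_generated_by_Basis) blast
    define N where "N = {F. closedin Y F \<and> F \<inter> A \<noteq> {}} \<inter> {F. closedin Y F \<and> F \<inter> B \<noteq> {}}"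
    have "openin (fell_topology Y) N"
      unfolding N_def by (intro openin_Int sub AB)
    moreover have "F \<in> N"
      using \<open>closedin Y F\<close> y z FY UV by (auto simp: N_def A_def B_def)
    ultimately obtain G where "G \<in> fibres Y X q" "G \<in> N"
      using cl unfolding in_closure_of by blast
    then show False
      using UV(5) by (auto simp: fibres_def N_def A_def B_def disjnt_iff)
  qed
  have "q ` F = {q y}"
    using y const by blast
  then show ?thesis
    by (simp add: q_star_def)
qed

definition singleton_fibres :: "'a topology \<Rightarrow> ('a \<Rightarrow> 'b) \<Rightarrow> 'a set" where
  "singleton_fibres Z r =
     {z \<in> topspace Z. {w \<in> topspace Z. r w = r z} = {z}}"

definition compact_type_point :: "'a topology \<Rightarrow> 'a \<Rightarrow> bool" where
  "compact_type_point X x \<longleftrightarrow>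
     x \<in> topspace X \<and>
     (\<exists>K. compactin X K \<and>
        (\<forall>s::nat \<Rightarrow> 'a. range s \<subseteq> topspace X \<and> limitin X s x sequentially \<longrightarrow>
           (\<forall>\<^sub>F n in sequentially. s n \<in> K)))"

definition sequentially_dense :: "'a topology \<Rightarrow> 'a set \<Rightarrow> bool" where
  "sequentially_dense X E \<longleftrightarrow>
     E \<subseteq> topspace X \<and>
     (\<forall>x \<in> topspace X. \<exists>s::nat \<Rightarrow> 'a. range s \<subseteq> E \<and> limitin X s x sequentially)"

definition property_a :: "'a topology \<Rightarrow> 'a set \<Rightarrow> bool" where
  "property_a X E \<longleftrightarrow>
     (\<forall>(x::nat \<Rightarrow> 'a) x0.
        inj x \<and> range x \<subseteq> E \<and> x0 \<in> topspace X \<and> limitin X x x0 sequentially \<longrightarrow>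
        (\<exists>r::nat \<Rightarrow> nat. strict_mono r \<and>
           (\<forall>s::nat \<Rightarrow> nat \<Rightarrow> 'a.
              (\<forall>n. range (s n) \<subseteq> topspace X \<and> limitin X (s n) (x (r n)) sequentially) \<longrightarrow>
              (\<exists>k::nat \<Rightarrow> nat.
                 compactin X (X closure_of {s n j | n j. k n \<le> j})))))"

(* The function J in the last line selects the diagonal sequence. *)
definition property_b :: "'a topology \<Rightarrow> 'a set \<Rightarrow> bool" where
  "property_b X E \<longleftrightarrow>
     (\<forall>(x::nat \<Rightarrow> 'a) x0.
        inj x \<and> range x \<subseteq> topspace X \<and> x0 \<in> topspace X \<and> limitin X x x0 sequentially \<longrightarrow>
        (\<exists>(r::nat \<Rightarrow> nat) (s::nat \<Rightarrow> nat \<Rightarrow> 'a).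
           strict_mono r \<and>
           (\<forall>n. range (s n) \<subseteq> E \<and> limitin X (s n) (x (r n)) sequentially) \<and>
           (\<forall>J::nat \<Rightarrow> nat. limitin X (\<lambda>n. s n (J n)) x0 sequentially)))"

end

theory Submission
  imports Defs
begin

text \<open>Two reductions carry the proof.

The first removes the hyperspace \<open>Y\<^sub>*\<close>. Call \<open>x\<close> a continuity point if, whenever an open \<open>W\<close> meets
\<open>q\<^sup>-\<^sup>1(x)\<close>, no sequence of points whose fibres miss \<open>W\<close> converges to \<open>x\<close>. Fibre maps of continuous
maps into Hausdorff spaces are always upper semicontinuous, so these are the points at which
\<open>x \<mapsto> q\<^sup>-\<^sup>1(x)\<close> is sequentially continuous for the Fell topology; since that topology is compact,
they are exactly the points with a singleton fibre in \<open>Y\<^sub>*\<close> (lemma \<open>singleton_fibres_eq\<close>).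
Let the core be the closure in \<open>Y\<close> of the set of points lying over continuity points. The members of
\<open>V\<close> are subsets of the core and cover it, and by compactness again \<open>q\<^sub>*\<close> restricted to \<open>V\<close> is a
quotient map iff \<open>q\<close> restricted to the core is one (lemma \<open>quotient_on_V_iff_quotient_on_core\<close>).
Irreducibility is then automatic: a closed set that maps onto \<open>X\<close> contains every singleton fibre.

The second shows that \<open>q\<close> restricted to the core is a quotient map iff (i) holds. Write
\<open>Y = \<Union>\<^sub>n K\<^sub>n\<close> with compact increasing \<open>K\<^sub>n\<close>; every compact subset of \<open>X\<close> lies in some \<open>q(K\<^sub>n)\<close>, and
closures inside \<open>q(K\<^sub>n)\<close> are sequential closures.

If the restriction to the core is a quotient map, then the set of continuity points serves as \<open>E\<close>.
For (a), part of the sequence lifts to a convergent sequence in \<open>Y\<close>, and its limit has a relatively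
compact open neighbourhood which by continuity all nearby fibres must meet. For (b), the quotient
property lifts part of the sequence to a convergent sequence in the core, whose terms are limits of
points lying over continuity points.

Conversely, let \<open>E\<close> be as in (i), and let \<open>O\<^sub>m\<close> be the set of points to which no sequence outside
\<open>q(K\<^sub>m)\<close> converges. Property (a) gives for each \<open>m\<close> an \<open>n\<close> with \<open>E \<inter> q(K\<^sub>m) \<subseteq> O\<^sub>n\<close>
(lemma \<open>uniform_compact_type\<close>). This uniformity and property (b) make a Baire category argument
possible inside a compact piece of \<open>X\<close>: each point of \<open>E \<inter> q(K\<^sub>k)\<close> is a limit of continuity points in
one \<open>q(K\<^sub>m)\<close> (lemma \<open>continuity_points_dense_near\<close>), so \<open>E \<inter> q(K\<^sub>k)\<close> is covered by the image of a
compact part of the core. A diagonal argument based on (b) extends this from \<open>E\<close> to sequences in \<open>X\<close>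
(lemma \<open>core_quotient\<close>).\<close>

section \<open>Subsequences and sequential closure\<close>

lemma eventually_imp_strict_mono_choice:
  assumes "\<And>n. \<forall>\<^sub>F k in sequentially. P n k"
  shows "\<exists>r::nat \<Rightarrow> nat. strict_mono r \<and> (\<forall>n. P n (r n))"
proof -
  have ex: "\<exists>k. P n k \<and> N < k" for n N
  proof -
    obtain M where "\<And>k. k \<ge> M \<Longrightarrow> P n k"
      using assms[of n] by (auto simp: eventually_sequentially)
    then show ?thesis
      by (intro exI[of _ "max M (Suc N)"]) auto
  qed
  have "\<exists>f. \<forall>n. P n (f n) \<and> f n < f (Suc n)"
    by (rule dependent_nat_choice[where Q = "\<lambda>n x y. x < y"]) (use ex in blast)+
  then show ?thesis
    by (auto simp: strict_mono_Suc_iff)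
qed

lemma not_eventually_imp_strict_mono_choice:
  assumes "\<not> (\<forall>\<^sub>F k in sequentially. P k)"
  shows "\<exists>r::nat \<Rightarrow> nat. strict_mono r \<and> (\<forall>n. \<not> P (r n))"
proof -
  have ex: "\<exists>k. \<not> P k \<and> N < k" for N
    using assms by (meson eventually_sequentiallyI less_le_not_le linorder_not_less Suc_le_eq)
  have "\<exists>f. \<forall>n. \<not> P (f n) \<and> f n < f (Suc n)"
    by (rule dependent_nat_choice[where Q = "\<lambda>n x y. x < y"]) (use ex in blast)+
  then show ?thesis
    by (auto simp: strict_mono_Suc_iff)
qed

lemma inj_subsequence_of_punctured_limit:
  assumes X: "t1_space X" and lim: "limitin X t e sequentially"
    and ne: "\<And>n. t n \<noteq> e" and top: "range t \<subseteq> topspace X"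
  shows "\<exists>r::nat \<Rightarrow> nat. strict_mono r \<and> inj (t \<circ> r)"
proof -
  have ex: "\<exists>k. N < k \<and> t k \<notin> t ` {..N}" for N
  proof -
    have "closedin X (t ` {..N})"
      using X top by (auto simp: t1_space_closedin_finite)
    then have "openin X (topspace X - t ` {..N})"
      by blast
    moreover have "e \<in> topspace X - t ` {..N}"
      using lim ne by (metis DiffI imageE limitin_topspace)
    ultimately have "\<forall>\<^sub>F k in sequentially. t k \<in> topspace X - t ` {..N}"
      using lim limitinD by metis
    then obtain M where "\<And>k. k \<ge> M \<Longrightarrow> t k \<notin> t ` {..N}"
      by (auto simp: eventually_sequentially)
    then show ?thesis
      by (intro exI[of _ "max M (Suc N)"]) auto
  qed
  have "\<exists>f. \<forall>n. True \<and> (f n < f (Suc n) \<and> t (f (Suc n)) \<notin> t ` {..f n})"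
    by (rule dependent_nat_choice[where Q = "\<lambda>n x y. x < y \<and> t y \<notin> t ` {..x}"]) (use ex in blast)+
  then obtain f where f: "\<And>n. f n < f (Suc n)" "\<And>n. t (f (Suc n)) \<notin> t ` {..f n}"
    by blast
  have mono: "strict_mono f"
    using f by (simp add: strict_mono_Suc_iff)
  have "t (f i) \<noteq> t (f j)" if ij: "i < j" for i j
  proof -
    obtain m where m: "j = Suc m"
      using ij by (cases j) auto
    then have "f i \<le> f m"
      using ij mono by (simp add: strict_mono_less_eq)
    then show ?thesis
      using f(2)[of m] m by (metis atMost_iff imageI)
  qed
  then have "inj (t \<circ> f)"
    by (intro linorder_injI) auto
  then show ?thesis
    using mono by blast
qed

definition seq_closure :: "'a topology \<Rightarrow> 'a set \<Rightarrow> 'a set" where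
  "seq_closure X B = {x. \<exists>s::nat \<Rightarrow> 'a. range s \<subseteq> B \<and> limitin X s x sequentially}"

lemma seq_closureI: "range s \<subseteq> B \<Longrightarrow> limitin X s x sequentially \<Longrightarrow> x \<in> seq_closure X B"
  by (auto simp: seq_closure_def)

lemma seq_closure_mono: "A \<subseteq> B \<Longrightarrow> seq_closure X A \<subseteq> seq_closure X B"
  by (auto simp: seq_closure_def)

lemma seq_closure_subset_closure: "seq_closure X B \<subseteq> X closure_of B"
proof
  fix x assume "x \<in> seq_closure X B"
  then obtain s :: "nat \<Rightarrow> 'a" where s: "range s \<subseteq> B" "limitin X s x sequentially"
    by (auto simp: seq_closure_def)
  show "x \<in> X closure_of B"
    unfolding in_closure_of
  proof (intro conjI allI impI)
    show "x \<in> topspace X"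
      using s(2) by (rule limitin_topspace)
    fix T assume "x \<in> T \<and> openin X T"
    then show "\<exists>y. y \<in> B \<and> y \<in> T"
      using s by (force simp: limitin_sequentially)
  qed
qed

lemma eventually_in_if_notin_seq_closure:
  assumes "x \<notin> seq_closure X (topspace X - A)"
    and s: "range s \<subseteq> topspace X" and lim: "limitin X s x sequentially"
  shows "\<forall>\<^sub>F n in sequentially. s n \<in> A"
proof (rule ccontr)
  assume "\<not> ?thesis"
  then obtain r :: "nat \<Rightarrow> nat" where r: "strict_mono r" "\<And>n. s (r n) \<notin> A"
    using not_eventually_imp_strict_mono_choice[of "\<lambda>n. s n \<in> A"] by blast
  have "x \<in> seq_closure X (topspace X - A)"
    using r s limitin_subsequence[OF r(1) lim] by (intro seq_closureI[of "s \<circ> r"]) auto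
  with assms(1) show False ..
qed

lemma metrizable_closure_eq_seq_closure:
  assumes "metrizable_space Y"
  shows "Y closure_of A = seq_closure Y (A \<inter> topspace Y)"
proof -
  obtain M d where M: "Metric_space M d" "Y = Metric_space.mtopology M d"
    using assms metrizable_space_def by blast
  interpret Metric_space M d by (rule M(1))
  show ?thesis
    unfolding M(2) seq_closure_def closure_of_sequentially
    by (auto simp: limitin_metric)
qed

lemma metrizable_compact_subsequence:
  assumes "metrizable_space Y" "compactin Y K" "range s \<subseteq> K"
  shows "\<exists>l (r::nat \<Rightarrow> nat). l \<in> K \<and> strict_mono r \<and> limitin Y (s \<circ> r) l sequentially"
proof -
  obtain M d where M: "Metric_space M d" "Y = Metric_space.mtopology M d"
    using assms(1) metrizable_space_def by blast
  interpret Metric_space M d by (rule M(1))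
  show ?thesis
    using assms(2,3) unfolding M(2) compactin_sequentially by blast
qed

text \<open>The sets \<open>B n\<close> are balls around \<open>y\<close> with radii tending to zero. Stating it with sequences lets
all diagonal sequences of property (b) be handled at once.\<close>

lemma metrizable_shrinking_neighbourhoods:
  assumes "metrizable_space Y" "y \<in> topspace Y"
  shows "\<exists>B::nat \<Rightarrow> 'a set. (\<forall>n. openin Y (B n) \<and> y \<in> B n) \<and>
           (\<forall>s. (\<forall>n. s n \<in> B n) \<longrightarrow> limitin Y s y sequentially)"
proof -
  obtain M d where M: "Metric_space M d" "Y = Metric_space.mtopology M d"
    using assms(1) metrizable_space_def by blast
  interpret Metric_space M d by (rule M(1))
  have y: "y \<in> M"
    using assms(2) M(2) by simp
  define B where "B n = mball y (inverse (Suc n))" for n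
  have "limitin Y s y sequentially" if s: "\<And>n. s n \<in> B n" for s
    unfolding M(2) limitin_metric_dist_null
  proof (intro conjI)
    show "\<forall>\<^sub>F n in sequentially. s n \<in> M"
      using s by (auto simp: B_def)
    show "(\<lambda>n. d (s n) y) \<longlonglongrightarrow> 0"
    proof (rule Lim_null_comparison)
      show "\<forall>\<^sub>F n in sequentially. norm (d (s n) y) \<le> inverse (real (Suc n))"
        using s by (intro always_eventually) (auto simp: B_def commute less_imp_le)
      show "(\<lambda>n. inverse (real (Suc n))) \<longlonglongrightarrow> 0"
        by (rule LIMSEQ_inverse_real_of_nat)
    qed
  qed (rule y)
  moreover have "openin Y (B n) \<and> y \<in> B n" for n
    using y by (auto simp: B_def M(2))
  ultimately show ?thesis
    by blast
qed

lemma separable_metrizable_imp_second_countable: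
  assumes "metrizable_space Y" "separable_space Y"
  shows "second_countable Y"
proof -
  obtain M d where M: "Metric_space M d" "Y = Metric_space.mtopology M d"
    using assms(1) metrizable_space_def by blast
  interpret Metric_space M d by (rule M(1))
  obtain C where C: "countable C" "C \<subseteq> M" "Y closure_of C = M"
    using assms(2) unfolding separable_space_def M(2) by auto
  define \<B> where "\<B> = (\<lambda>(c, n). mball c (inverse (Suc n))) ` (C \<times> (UNIV::nat set))"
  have "\<exists>V\<in>\<B>. x \<in> V \<and> V \<subseteq> W" if W: "openin Y W" "x \<in> W" for W x
  proof -
    have x: "x \<in> M"
      using W openin_subset unfolding M(2) by fastforce
    obtain r where r: "r > 0" "mball x r \<subseteq> W"
      using W unfolding M(2) openin_mtopology by blast
    obtain n where n: "inverse (Suc n) < r / 2"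
      using reals_Archimedean[of "r/2"] r by auto
    have "x \<in> Y closure_of C"
      using x C by simp
    moreover have "openin Y (mball x (inverse (Suc n)))" "x \<in> mball x (inverse (Suc n))"
      using x M(2) by auto
    ultimately obtain c where c: "c \<in> C" "c \<in> mball x (inverse (Suc n))"
      unfolding in_closure_of by blast
    have "mball c (inverse (Suc n)) \<subseteq> mball x r"
    proof
      fix z assume "z \<in> mball c (inverse (Suc n))"
      then have "z \<in> M" "c \<in> M" "d c z < r/2" "d x c < r/2"
        using c n by auto
      then show "z \<in> mball x r"
        using triangle[of x c z] x by auto
    qed
    moreover have "x \<in> mball c (inverse (Suc n))"
      using c x by (auto simp: commute)
    ultimately show ?thesis
      using r c unfolding \<B>_def by blast
  qed
  moreover have "countable \<B>"
    using C unfolding \<B>_def by blast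
  moreover have "\<forall>V\<in>\<B>. openin Y V"
    unfolding \<B>_def M(2) by auto
  ultimately show ?thesis
    unfolding second_countable_def by blast
qed

lemma standard_space_countable_base:
  assumes "standard_space Y"
  shows "\<exists>U::nat \<Rightarrow> 'a set. (\<forall>i. openin Y (U i) \<and> compactin Y (Y closure_of U i)) \<and>
           (\<forall>W y. openin Y W \<and> y \<in> W \<longrightarrow> (\<exists>i. y \<in> U i \<and> Y closure_of U i \<subseteq> W))"
proof -
  have met: "metrizable_space Y" and lc: "locally_compact_space Y" and sep: "separable_space Y"
    using assms by (auto simp: standard_space_def)
  have haus: "Hausdorff_space Y"
    using met by (rule metrizable_imp_Hausdorff_space)
  obtain \<B> where \<B>: "countable \<B>" "\<And>V. V \<in> \<B> \<Longrightarrow> openin Y V"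
      "\<And>W y. openin Y W \<Longrightarrow> y \<in> W \<Longrightarrow> \<exists>V\<in>\<B>. y \<in> V \<and> V \<subseteq> W"
    using separable_metrizable_imp_second_countable[OF met sep] unfolding second_countable_def by metis
  define \<C> where "\<C> = insert {} {V \<in> \<B>. compactin Y (Y closure_of V)}"
  have "countable \<C>" "\<C> \<noteq> {}"
    using \<B>(1) by (auto simp: \<C>_def)
  then have ran: "range (from_nat_into \<C>) = \<C>"
    by (rule range_from_nat_into[rotated])
  have "\<exists>V\<in>\<C>. y \<in> V \<and> Y closure_of V \<subseteq> W" if W: "openin Y W" "y \<in> W" for W y
  proof -
    have "neighbourhood_base_of (compactin Y) Y"
      using lc locally_compact_space_neighbourhood_base haus by blast
    then obtain N C where N: "openin Y N" "compactin Y C" "y \<in> N" "N \<subseteq> C" "C \<subseteq> W"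
      using W unfolding neighbourhood_base_of by metis
    obtain V where V: "V \<in> \<B>" "y \<in> V" "V \<subseteq> N"
      using \<B>(3) N by blast
    have "Y closure_of V \<subseteq> C"
      using V N compactin_imp_closedin[OF haus] by (intro closure_of_minimal) auto
    moreover from this have "compactin Y (Y closure_of V)"
      by (rule closed_compactin[OF N(2) _ closedin_closure_of])
    ultimately show ?thesis
      using V N unfolding \<C>_def by blast
  qed
  moreover have "openin Y V \<and> compactin Y (Y closure_of V)" if "V \<in> \<C>" for V
    using that \<B>(2) by (auto simp: \<C>_def)
  ultimately show ?thesis
    using ran by (intro exI[of _ "from_nat_into \<C>"]) (smt (verit) imageE rangeI)
qed

section \<open>Quotients with a countable base of relatively compact sets upstairs\<close>

text \<open>A standard space enters the argument only through metrizability and a countable base \<open>U\<close> of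
relatively compact open sets in which closures of basic sets can be made arbitrarily small. The same
sequence \<open>U\<close> gives the compact exhaustion \<open>K\<close> and the countable family of closed sets
\<open>q ` (Y closure_of U i)\<close> to which the Baire category theorem is applied.\<close>

locale standard_quotient =
  fixes Y :: "'a topology" and X :: "'b topology" and q :: "'a \<Rightarrow> 'b" and U :: "nat \<Rightarrow> 'a set"
  assumes metrizable: "metrizable_space Y"
    and openin_U: "\<And>i. openin Y (U i)"
    and compactin_closure_U: "\<And>i. compactin Y (Y closure_of U i)"
    and base_U: "\<And>W y. openin Y W \<Longrightarrow> y \<in> W \<Longrightarrow> \<exists>i. y \<in> U i \<and> Y closure_of U i \<subseteq> W"
    and Hausdorff_X: "Hausdorff_space X"
    and quotient: "quotient_map Y X q"
begin

definition K :: "nat \<Rightarrow> 'a set" where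
  "K n = (\<Union>i\<le>n. Y closure_of U i)"

lemma Hausdorff_Y: "Hausdorff_space Y"
  by (rule metrizable_imp_Hausdorff_space[OF metrizable])

lemma t1_X: "t1_space X"
  by (rule Hausdorff_imp_t1_space[OF Hausdorff_X])

lemma continuous_q: "continuous_map Y X q"
  by (rule quotient_imp_continuous_map[OF quotient])

lemma q_image: "q ` topspace Y = topspace X"
  by (rule quotient_imp_surjective_map[OF quotient])

lemma q_in: "y \<in> topspace Y \<Longrightarrow> q y \<in> topspace X"
  using q_image by blast

lemma q_lift: "x \<in> topspace X \<Longrightarrow> \<exists>y. y \<in> topspace Y \<and> q y = x"
  unfolding q_image[symmetric] by blast

lemma U_subset_closure: "U i \<subseteq> Y closure_of U i"
  using openin_U[of i] by (simp add: closure_of_subset openin_subset)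

lemma compactin_K: "compactin Y (K n)"
  unfolding K_def by (rule compactin_Union) (auto simp: compactin_closure_U)

lemma K_mono: "m \<le> n \<Longrightarrow> K m \<subseteq> K n"
  unfolding K_def by (intro UN_mono) auto

lemma K_subset: "K n \<subseteq> topspace Y"
  using compactin_K by (rule compactin_subset_topspace)

lemma closure_U_subset_K: "Y closure_of U i \<subseteq> K i"
  unfolding K_def by blast

lemma U_subset_K: "U i \<subseteq> K i"
  using U_subset_closure closure_U_subset_K by blast

lemma in_some_K: "y \<in> topspace Y \<Longrightarrow> \<exists>n. y \<in> K n"
  using base_U[of "topspace Y" y] U_subset_K by blast

lemma compactin_q_image: "compactin Y C \<Longrightarrow> compactin X (q ` C)"
  by (rule image_compactin[OF _ continuous_q])

lemma closedin_q_image: "compactin Y C \<Longrightarrow> closedin X (q ` C)"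
  by (intro compactin_imp_closedin[OF Hausdorff_X] compactin_q_image)

lemma qK_mono: "m \<le> n \<Longrightarrow> q ` K m \<subseteq> q ` K n"
  by (intro image_mono K_mono)

lemma qK_subset: "q ` K m \<subseteq> topspace X"
  using K_subset q_in by blast

lemma in_some_qK: "x \<in> topspace X \<Longrightarrow> \<exists>n. x \<in> q ` K n"
  unfolding q_image[symmetric] using in_some_K by blast

lemma closedin_preimage_iff:
  assumes "C \<subseteq> topspace X"
  shows "closedin Y {y \<in> topspace Y. q y \<in> C} \<longleftrightarrow> closedin X C"
  using quotient assms by (auto simp: quotient_map_closedin)

lemma limitin_q: "limitin Y s y sequentially \<Longrightarrow> limitin X (\<lambda>n. q (s n)) (q y) sequentially"
  using continuous_map_limit[OF continuous_q, of s y sequentially] by (simp add: o_def)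

text \<open>Every \<open>U i\<close> lies in \<open>K i\<close> and therefore meets only finitely many of the fibres over the \<open>t n\<close>. The
union of any of these fibres is thus locally a finite union of closed sets.\<close>

lemma closedin_of_escaping:
  assumes top: "range t \<subseteq> topspace X" and esc: "\<And>n::nat. t n \<notin> q ` K n"
  shows "closedin X (t ` I)"
proof -
  have fin: "closedin X (t ` J)" if "finite J" for J
    using t1_X top that by (auto simp: t1_space_closedin_finite)
  define P where "P A = {y \<in> topspace Y. q y \<in> A}" for A
  have "Y closure_of P (t ` I) \<subseteq> P (t ` I)"
  proof
    fix y assume y: "y \<in> Y closure_of P (t ` I)"
    then have "y \<in> topspace Y"
      by (simp add: in_closure_of)
    then obtain i where i: "y \<in> U i"
      using base_U[of "topspace Y" y] by blast
    have "U i \<inter> P (t ` I) \<subseteq> P (t ` (I \<inter> {..i}))"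
    proof
      fix z assume z: "z \<in> U i \<inter> P (t ` I)"
      then obtain n where n: "n \<in> I" "q z = t n"
        by (auto simp: P_def)
      have "z \<in> K i"
        using z U_subset_K by blast
      have "n \<le> i"
      proof (rule ccontr)
        assume "\<not> n \<le> i"
        then have "z \<in> K n"
          using \<open>z \<in> K i\<close> K_mono[of i n] by auto
        then show False
          using esc[of n] n by (metis imageI)
      qed
      then show "z \<in> P (t ` (I \<inter> {..i}))"
        using z n by (auto simp: P_def)
    qed
    moreover have "closedin Y (P (t ` (I \<inter> {..i})))"
      unfolding P_def by (intro closedin_continuous_map_preimage[OF continuous_q] fin) auto
    ultimately have "Y closure_of (U i \<inter> P (t ` I)) \<subseteq> P (t ` (I \<inter> {..i}))"
      by (rule closure_of_minimal)
    then have "y \<in> P (t ` (I \<inter> {..i}))"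
      using openin_Int_closure_of_subset[OF openin_U[of i], of "P (t ` I)"] y i by blast
    then show "y \<in> P (t ` I)"
      by (auto simp: P_def)
  qed
  then have "closedin Y (P (t ` I))"
    by (metis (no_types, lifting) P_def closure_of_subset_eq mem_Collect_eq subsetI)
  then show ?thesis
    unfolding P_def using closedin_preimage_iff[of "t ` I"] top by blast
qed

text \<open>Otherwise a sequence with \<open>t n \<notin> q ` K n\<close> could be chosen in \<open>C\<close>; by the previous lemma its range is
an infinite closed discrete subset of \<open>C\<close>.\<close>

lemma compactin_subset_some_qK:
  assumes C: "compactin X C"
  shows "\<exists>n. C \<subseteq> q ` K n"
proof (rule ccontr)
  assume "\<not> ?thesis"
  then have "\<forall>n. \<exists>x. x \<in> C \<and> x \<notin> q ` K n"
    by blast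
  then obtain t where t: "\<And>n. t n \<in> C" "\<And>n. t n \<notin> q ` K n"
    by metis
  have top: "range t \<subseteq> topspace X"
    using t(1) compactin_subset_topspace[OF C] by blast
  have "infinite (range t)"
  proof
    assume fin: "finite (range t)"
    obtain m where m: "\<And>x. x \<in> range t \<Longrightarrow> x \<in> q ` K (m x)"
      using in_some_qK top by (metis subsetD)
    define N where "N = Max (m ` range t)"
    have "t N \<in> q ` K (m (t N))"
      using m by blast
    moreover have "m (t N) \<le> N"
      unfolding N_def using fin by (intro Max_ge) auto
    ultimately show False
      using t(2)[of N] qK_mono by blast
  qed
  then obtain a where a: "a \<in> X derived_set_of range t"
    using compactin_imp_Bolzano_Weierstrass[OF C, of "range t"] t(1) by blast
  have "closedin X (range t - {a})"
  proof -
    have "range t - {a} = t ` {n. t n \<noteq> a}"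
      by auto
    then show ?thesis
      using closedin_of_escaping[OF top t(2)] by simp
  qed
  then have "openin X (topspace X - (range t - {a}))"
    by blast
  moreover have "a \<in> topspace X - (range t - {a})"
    using a by (simp add: in_derived_set_of)
  ultimately obtain z where "z \<noteq> a" "z \<in> range t" "z \<in> topspace X - (range t - {a})"
    using a unfolding in_derived_set_of by metis
  then show False
    by blast
qed

lemma convergent_sequence_in_some_qK:
  assumes "range s \<subseteq> topspace X" "limitin X s x sequentially"
  shows "\<exists>n. range s \<subseteq> q ` K n"
  using compactin_subset_some_qK[OF compactin_sequence_with_limit[OF assms(2) order_refl assms(1)]]
  by blast

text \<open>\<open>X\<close> itself need not be a Frechet-Urysohn space, but closure points of subsets of \<open>q ` K n\<close> lift to the
metrizable space \<open>Y\<close>, where they are limits of sequences.\<close>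

lemma closure_eq_seq_closure_in_qK:
  assumes "A \<subseteq> q ` K n" "x \<in> X closure_of A"
  shows "x \<in> seq_closure X A"
proof -
  define B where "B = {y \<in> K n. q y \<in> A}"
  have BK: "Y closure_of B \<subseteq> K n"
    using compactin_imp_closedin[OF Hausdorff_Y compactin_K] by (intro closure_of_minimal) (auto simp: B_def)
  then have cpt: "compactin Y (Y closure_of B)"
    by (rule closed_compactin[OF compactin_K _ closedin_closure_of])
  have "B \<subseteq> Y closure_of B"
    using K_subset by (intro closure_of_subset) (auto simp: B_def)
  then have "A \<subseteq> q ` (Y closure_of B)"
    using assms(1) by (force simp: B_def)
  then have "X closure_of A \<subseteq> q ` (Y closure_of B)"
    by (rule closure_of_minimal[OF _ closedin_q_image[OF cpt]])
  then obtain y where y: "y \<in> Y closure_of B" "q y = x"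
    using assms(2) by blast
  then obtain s :: "nat \<Rightarrow> 'a" where s: "range s \<subseteq> B" "limitin Y s y sequentially"
    unfolding metrizable_closure_eq_seq_closure[OF metrizable] by (auto simp: seq_closure_def)
  have "limitin X (\<lambda>n. q (s n)) x sequentially"
    using limitin_q[OF s(2)] y by simp
  then show ?thesis
    using s(1) by (intro seq_closureI[of "\<lambda>n. q (s n)"]) (auto simp: B_def)
qed

lemma convergent_subsequence_in_qK:
  assumes "range s \<subseteq> q ` K n"
  shows "\<exists>(r::nat \<Rightarrow> nat) y l. strict_mono r \<and> limitin Y y l sequentially \<and> range y \<subseteq> K n \<and> (\<forall>k. q (y k) = s (r k))"
proof -
  have "\<forall>k. \<exists>y. y \<in> K n \<and> q y = s k"
    using assms by (metis imageE rangeI subsetD)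
  then obtain y where y: "\<And>k. y k \<in> K n" "\<And>k. q (y k) = s k"
    by metis
  obtain l and r :: "nat \<Rightarrow> nat" where lr: "strict_mono r" "limitin Y (y \<circ> r) l sequentially"
    using metrizable_compact_subsequence[OF metrizable compactin_K, of y n] y(1) by blast
  show ?thesis
    by (intro exI[of _ r] exI[of _ "y \<circ> r"] exI[of _ l]) (use lr y in auto)
qed

section \<open>Sequential continuity points of the fibre map\<close>

text \<open>The condition says that the fibre map is lower semicontinuous along sequences at \<open>x\<close>: if \<open>W\<close> meets
the fibre over \<open>x\<close>, then it meets the fibres over almost all terms of any sequence that converges
to \<open>x\<close>.\<close>

definition continuity_points :: "'b set" where
  "continuity_points =
     {x \<in> topspace X. \<forall>W. openin Y W \<and> x \<in> q ` W \<longrightarrow> x \<notin> seq_closure X (topspace X - q ` W)}"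

definition core :: "'a set" where
  "core = Y closure_of {y \<in> topspace Y. q y \<in> continuity_points}"

lemma eventually_in_q_image:
  assumes "x \<in> continuity_points" "openin Y W" "x \<in> q ` W"
    and "range s \<subseteq> topspace X" "limitin X s x sequentially"
  shows "\<forall>\<^sub>F n in sequentially. s n \<in> q ` W"
  using assms by (intro eventually_in_if_notin_seq_closure[where X = X]) (auto simp: continuity_points_def)

text \<open>It suffices to test countably many sets, namely the images of the closures of the basic sets: a smaller image has a
larger complement. This countability is what makes Baire category applicable.\<close>

lemma continuity_pointsI:
  assumes "x \<in> topspace X"
    and T: "\<And>i. x \<in> q ` (Y closure_of U i) \<Longrightarrow> x \<notin> seq_closure X (topspace X - q ` (Y closure_of U i))"
  shows "x \<in> continuity_points"
  unfolding continuity_points_def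
proof (intro CollectI conjI allI impI assms(1))
  fix W assume W: "openin Y W \<and> x \<in> q ` W"
  then obtain y where y: "y \<in> W" "q y = x"
    by blast
  then obtain i where i: "y \<in> U i" "Y closure_of U i \<subseteq> W"
    using base_U W by blast
  then have "x \<in> q ` (Y closure_of U i)"
    using y U_subset_closure by blast
  moreover have "topspace X - q ` W \<subseteq> topspace X - q ` (Y closure_of U i)"
    using i(2) by blast
  ultimately show "x \<notin> seq_closure X (topspace X - q ` W)"
    using T[of i] seq_closure_mono by blast
qed

lemma continuity_points_subset: "continuity_points \<subseteq> topspace X"
  by (auto simp: continuity_points_def)

lemma closedin_core: "closedin Y core"
  unfolding core_def by simp

lemma core_subset: "core \<subseteq> topspace Y"
  using closedin_core by (rule closedin_subset)

section \<open>From a quotient on the core to the sequential properties\<close>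

lemma continuity_point_compact_type:
  assumes x: "x \<in> continuity_points"
  shows "compact_type_point X x"
proof -
  have xX: "x \<in> topspace X"
    using x continuity_points_subset by blast
  then obtain y where y: "y \<in> topspace Y" "q y = x"
    using q_lift by blast
  then obtain i where i: "y \<in> U i"
    using base_U[of "topspace Y" y] by blast
  have "\<forall>\<^sub>F n in sequentially. s n \<in> q ` (Y closure_of U i)"
    if "range s \<subseteq> topspace X" "limitin X s x sequentially" for s
    using eventually_in_q_image[OF x openin_U[of i] _ that] i y U_subset_closure[of i]
    by (force elim: eventually_mono)
  then show ?thesis
    unfolding compact_type_point_def
    using xX compactin_q_image[OF compactin_closure_U] by blast
qed

lemma core_sequence:
  assumes "y \<in> core" "openin Y W" "y \<in> W"
  shows "\<exists>s. range s \<subseteq> {z \<in> W. q z \<in> continuity_points} \<and> limitin Y s y sequentially"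
proof -
  have "y \<in> Y closure_of (W \<inter> {z \<in> topspace Y. q z \<in> continuity_points})"
    using openin_Int_closure_of_subset[OF assms(2)] assms(1,3) unfolding core_def by blast
  then show ?thesis
    unfolding metrizable_closure_eq_seq_closure[OF metrizable] seq_closure_def by blast
qed

lemma sequentially_dense_continuity_points:
  assumes "q ` core = topspace X"
  shows "sequentially_dense X continuity_points"
  unfolding sequentially_dense_def
proof (intro conjI ballI continuity_points_subset)
  fix x assume "x \<in> topspace X"
  then have "x \<in> q ` core"
    by (simp add: assms)
  then obtain y where y: "y \<in> core" "q y = x"
    by blast
  then obtain s where s: "range s \<subseteq> {z \<in> topspace Y. q z \<in> continuity_points}" "limitin Y s y sequentially"
    using core_sequence[OF y(1) openin_topspace set_mp[OF core_subset y(1)]] by (elim exE conjE)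
  then show "\<exists>s. range s \<subseteq> continuity_points \<and> limitin X s x sequentially"
    using limitin_q[OF s(2)] y by (intro exI[of _ "\<lambda>n. q (s n)"]) auto
qed

text \<open>A subsequence lifts to a convergent sequence in \<open>Y\<close>, whose terms eventually lie in one relatively
compact \<open>U i\<close>. So \<open>U i\<close> meets the fibres over all terms, and by continuity also almost all fibres
over each sequence approaching one of them; hence everything happens inside the compact set
\<open>q ` (Y closure_of U i)\<close>.\<close>

lemma property_a_continuity_points: "property_a X continuity_points"
  unfolding property_a_def
proof (intro allI impI, elim conjE)
  fix x :: "nat \<Rightarrow> 'b" and x0
  assume x: "range x \<subseteq> continuity_points" and lim: "limitin X x x0 sequentially"
  obtain n where "range x \<subseteq> q ` K n"
    using convergent_sequence_in_some_qK[OF _ lim] x continuity_points_subset by blast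
  then obtain r y l where r: "strict_mono (r::nat \<Rightarrow> nat)" and l: "limitin Y y l sequentially"
      and y: "\<forall>k. q (y k) = x (r k)"
    using convergent_subsequence_in_qK by blast
  obtain i where i: "l \<in> U i"
    using base_U[of "topspace Y" l] limitin_topspace[OF l] by blast
  obtain N where N: "\<And>k. k \<ge> N \<Longrightarrow> y k \<in> U i"
    using limitinD[OF l openin_U i] by (auto simp: eventually_sequentially)
  define r' where "r' k = r (k + N)" for k
  have r': "strict_mono r'"
    using r by (auto simp: r'_def strict_mono_def)
  have xU: "x (r' k) \<in> q ` U i" for k
    using N[of "k + N"] y by (metis r'_def imageI le_add2)
  show "\<exists>r::nat \<Rightarrow> nat. strict_mono r \<and>
           (\<forall>s. (\<forall>n. range (s n) \<subseteq> topspace X \<and> limitin X (s n) (x (r n)) sequentially) \<longrightarrow>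
              (\<exists>k. compactin X (X closure_of {s n j |n j. k n \<le> j})))"
  proof (rule exI[of _ r'], intro conjI r' allI impI)
    fix s :: "nat \<Rightarrow> nat \<Rightarrow> 'b"
    assume s: "\<forall>n. range (s n) \<subseteq> topspace X \<and> limitin X (s n) (x (r' n)) sequentially"
    have "\<forall>\<^sub>F j in sequentially. s n j \<in> q ` U i" for n
      by (rule eventually_in_q_image[OF _ openin_U xU]) (use s x in auto)
    then obtain k where k: "\<And>n j. k n \<le> j \<Longrightarrow> s n j \<in> q ` U i"
      unfolding eventually_sequentially by metis
    have cpt: "compactin X (q ` (Y closure_of U i))"
      by (rule compactin_q_image[OF compactin_closure_U])
    have "X closure_of {s n j |n j. k n \<le> j} \<subseteq> q ` (Y closure_of U i)"
      using k U_subset_closure[of i]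
      by (intro closure_of_minimal compactin_imp_closedin[OF Hausdorff_X cpt]) blast
    then have "compactin X (X closure_of {s n j |n j. k n \<le> j})"
      by (rule closed_compactin[OF cpt _ closedin_closure_of])
    then show "\<exists>k. compactin X (X closure_of {s n j |n j. k n \<le> j})"
      by (rule exI[of _ k])
  qed
qed

text \<open>The range of \<open>x\<close> without \<open>x0\<close> is not closed in \<open>X\<close>, so for a quotient map its preimage in the core is
not closed either; a missing limit point of that preimage must lie over \<open>x0\<close>, and a sequence
converging to it runs through infinitely many different \<open>x n\<close>.\<close>

lemma lift_convergent_sequence_to_core:
  assumes core: "quotient_map (subtopology Y core) X q"
    and inj: "inj x" and x: "range x \<subseteq> topspace X" and lim: "limitin X x x0 sequentially"
  shows "\<exists>(r::nat \<Rightarrow> nat) y l. strict_mono r \<and> range y \<subseteq> core \<and> limitin Y y l sequentially \<and> q l = x0 \<and>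
           (\<forall>n. q (y n) = x (r n))"
proof -
  define C where "C = range x - {x0}"
  have x0: "x0 \<in> topspace X"
    using lim by (rule limitin_topspace)
  have CX: "C \<subseteq> topspace X"
    using x by (auto simp: C_def)
  have clC: "X closure_of C \<subseteq> insert x0 C"
  proof (rule closure_of_minimal)
    show "closedin X (insert x0 C)"
      by (intro compactin_imp_closedin[OF Hausdorff_X] compactin_sequence_with_limit[OF lim _ CX]) (auto simp: C_def)
  qed auto
  have "\<not> closedin X C"
  proof
    assume "closedin X C"
    then have "openin X (topspace X - C)" "x0 \<in> topspace X - C"
      using x0 by (auto simp: C_def)
    then obtain N where N: "\<And>n. n \<ge> N \<Longrightarrow> x n \<in> topspace X - C"
      using lim unfolding limitin_sequentially by metis
    have "x N = x0" "x (Suc N) = x0"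
      using N[of N] N[of "Suc N"] by (auto simp: C_def)
    then show False
      using inj by (metis injD n_not_Suc_n)
  qed
  then have "\<not> closedin (subtopology Y core) {y \<in> topspace (subtopology Y core). q y \<in> C}"
    using core CX unfolding quotient_map_closedin by simp
  moreover define A where "A = {y \<in> core. q y \<in> C}"
  moreover have "{y \<in> topspace (subtopology Y core). q y \<in> C} = A"
    using core_subset by (auto simp: A_def)
  ultimately have "\<not> closedin Y A"
    by (metis A_def closedin_closed_subtopology closedin_core mem_Collect_eq subsetI)
  moreover have "A \<subseteq> topspace Y"
    using core_subset by (auto simp: A_def)
  ultimately obtain l where l: "l \<in> Y closure_of A" "l \<notin> A"
    by (metis closure_of_subset_eq subsetI)
  then obtain y where y: "range y \<subseteq> A" "limitin Y y l sequentially"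
    unfolding metrizable_closure_eq_seq_closure[OF metrizable] seq_closure_def by blast
  have "l \<in> core"
    using l(1) closure_of_minimal[OF _ closedin_core, of A] by (auto simp: A_def)
  then have "q l \<notin> C"
    using l(2) by (simp add: A_def)
  moreover have "q l \<in> X closure_of C"
    using y(1) limitin_q[OF y(2)]
    by (intro set_mp[OF seq_closure_subset_closure] seq_closureI[of "\<lambda>n. q (y n)"]) (auto simp: A_def)
  ultimately have ql: "q l = x0"
    using clC by blast
  have "\<forall>n. \<exists>m. q (y n) = x m"
    using y(1) by (fastforce simp: A_def C_def)
  then obtain m where m: "\<And>n. q (y n) = x (m n)"
    by metis
  have ne: "x (m n) \<noteq> x0" for n
    using y(1) m[of n] by (force simp: A_def C_def)
  have ev: "\<forall>\<^sub>F n in sequentially. k < m n" for k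
  proof -
    have "finite (x ` {..k} - {x0})" "x ` {..k} - {x0} \<subseteq> topspace X"
      using x by auto
    then have "closedin X (x ` {..k} - {x0})"
      using t1_X by (simp add: t1_space_closedin_finite)
    then have "openin X (topspace X - (x ` {..k} - {x0}))" "q l \<in> topspace X - (x ` {..k} - {x0})"
      using x0 ql by auto
    then have "\<forall>\<^sub>F n in sequentially. q (y n) \<in> topspace X - (x ` {..k} - {x0})"
      by (rule limitinD[OF limitin_q[OF y(2)]])
    then show ?thesis
      using m ne by (auto elim!: eventually_mono simp: not_le[symmetric])
  qed
  have "\<exists>f. \<forall>n. True \<and> (f n < f (Suc n) \<and> m (f n) < m (f (Suc n)))"
  proof (rule dependent_nat_choice[where Q = "\<lambda>n a b. a < b \<and> m a < m b"])
    fix a n :: nat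
    have "\<forall>\<^sub>F b in sequentially. a < b \<and> m a < m b"
      using eventually_gt_at_top[of a] ev[of "m a"] by eventually_elim auto
    then show "\<exists>b. True \<and> (a < b \<and> m a < m b)"
      by (auto simp: eventually_sequentially)
  qed auto
  then obtain f where f: "\<And>n. f n < f (Suc n)" "\<And>n. m (f n) < m (f (Suc n))"
    by blast
  have "strict_mono f" "strict_mono (m \<circ> f)"
    using f by (auto simp: strict_mono_Suc_iff)
  then show ?thesis
    using y ql m limitin_subsequence[OF \<open>strict_mono f\<close> y(2)]
    by (intro exI[of _ "m \<circ> f"] exI[of _ "y \<circ> f"] exI[of _ l]) (auto simp: A_def)
qed

text \<open>The lifted terms lie in the core and so are limits of points over continuity points. Choosing the
\<open>n\<close>-th approximating sequence inside the \<open>n\<close>-th ball around the limit makes all diagonals converge.\<close>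

lemma property_b_continuity_points:
  assumes core: "quotient_map (subtopology Y core) X q"
  shows "property_b X continuity_points"
  unfolding property_b_def
proof (intro allI impI, elim conjE)
  fix x :: "nat \<Rightarrow> 'b" and x0
  assume "inj x" "range x \<subseteq> topspace X" "limitin X x x0 sequentially"
  then obtain r y l where r: "strict_mono (r::nat \<Rightarrow> nat)" and y: "range y \<subseteq> core" "limitin Y y l sequentially"
      and l: "q l = x0" and qy: "\<And>n. q (y n) = x (r n)"
    using lift_convergent_sequence_to_core[OF core] by metis
  obtain B where B: "\<And>n. openin Y (B n)" "\<And>n. l \<in> B n" "\<And>s. (\<And>n. s n \<in> B n) \<Longrightarrow> limitin Y s l sequentially"
    using metrizable_shrinking_neighbourhoods[OF metrizable limitin_topspace[OF y(2)]] by metis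
  obtain f where f: "strict_mono (f::nat \<Rightarrow> nat)" "\<And>n. y (f n) \<in> B n"
    using eventually_imp_strict_mono_choice[of "\<lambda>n k. y k \<in> B n"] limitinD[OF y(2) B(1) B(2)] by blast
  have "\<forall>n. \<exists>s. range s \<subseteq> {z \<in> B n. q z \<in> continuity_points} \<and> limitin Y s (y (f n)) sequentially"
    using core_sequence[OF _ B(1) f(2)] y(1) by blast
  then obtain s where s: "\<And>n. range (s n) \<subseteq> {z \<in> B n. q z \<in> continuity_points}"
      "\<And>n. limitin Y (s n) (y (f n)) sequentially"
    by metis
  show "\<exists>(r::nat \<Rightarrow> nat) s. strict_mono r \<and>
           (\<forall>n. range (s n) \<subseteq> continuity_points \<and> limitin X (s n) (x (r n)) sequentially) \<and>
           (\<forall>J. limitin X (\<lambda>n. s n (J n)) x0 sequentially)"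
  proof (intro exI[of _ "r \<circ> f"] exI[of _ "\<lambda>n j. q (s n j)"] conjI allI)
    show "strict_mono (r \<circ> f)"
      using r f(1) by (simp add: strict_mono_o)
    show "range (\<lambda>j. q (s n j)) \<subseteq> continuity_points" for n
      using s(1)[of n] by auto
    show "limitin X (\<lambda>j. q (s n j)) (x ((r \<circ> f) n)) sequentially" for n
      using limitin_q[OF s(2)[of n]] qy[of "f n"] by simp
    show "limitin X (\<lambda>n. q (s n (J n))) x0 sequentially" for J
      using limitin_q[OF B(3)[of "\<lambda>n. s n (J n)"]] s(1) l by blast
  qed
qed

section \<open>From the sequential properties to a quotient on the core\<close>

text \<open>This is the sequential interior of \<open>q ` K m\<close>. In general it is not open, not even in \<open>q ` K m\<close>.\<close>

definition seq_interior_K :: "nat \<Rightarrow> 'b set" where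
  "seq_interior_K m = topspace X - seq_closure X (topspace X - q ` K m)"

lemma seq_interior_K_mono: "m \<le> n \<Longrightarrow> seq_interior_K m \<subseteq> seq_interior_K n"
  unfolding seq_interior_K_def by (intro Diff_mono seq_closure_mono order_refl qK_mono)

lemma eventually_in_qK:
  assumes "x \<in> seq_interior_K m" "range s \<subseteq> topspace X" "limitin X s x sequentially"
  shows "\<forall>\<^sub>F n in sequentially. s n \<in> q ` K m"
  using assms by (intro eventually_in_if_notin_seq_closure[where X = X]) (auto simp: seq_interior_K_def)

lemma seq_interior_K_notin_closure:
  assumes "x \<in> seq_interior_K m"
  shows "x \<notin> X closure_of (q ` K k - q ` K m)"
proof
  assume "x \<in> X closure_of (q ` K k - q ` K m)"
  then have "x \<in> seq_closure X (q ` K k - q ` K m)"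
    by (rule closure_eq_seq_closure_in_qK[rotated]) blast
  moreover have "q ` K k - q ` K m \<subseteq> topspace X - q ` K m"
    using qK_subset by blast
  ultimately show False
    using assms seq_closure_mono unfolding seq_interior_K_def by blast
qed

lemma compact_type_point_in_seq_interior_K:
  assumes "compact_type_point X x"
  shows "\<exists>m. x \<in> seq_interior_K m"
proof -
  obtain C where x: "x \<in> topspace X" and C: "compactin X C"
    and ev: "\<And>s. range s \<subseteq> topspace X \<Longrightarrow> limitin X s x sequentially \<Longrightarrow> \<forall>\<^sub>F n in sequentially. s n \<in> C"
    using assms unfolding compact_type_point_def by blast
  obtain m where m: "C \<subseteq> q ` K m"
    using compactin_subset_some_qK[OF C] by blast
  have "x \<notin> seq_closure X (topspace X - q ` K m)"
  proof
    assume "x \<in> seq_closure X (topspace X - q ` K m)"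
    then obtain s where s: "range s \<subseteq> topspace X - q ` K m" "limitin X s x sequentially"
      unfolding seq_closure_def by blast
    then have "\<forall>\<^sub>F n in sequentially. s n \<in> C"
      using ev by blast
    then obtain N where "s N \<in> C"
      by (auto simp: eventually_sequentially)
    then show False
      using m s(1) by blast
  qed
  then show ?thesis
    using x unfolding seq_interior_K_def by blast
qed

lemma property_aE:
  assumes a: "property_a X E" and x: "inj x" "range x \<subseteq> E" "limitin X x x0 sequentially"
  obtains r where "strict_mono (r::nat \<Rightarrow> nat)"
    "\<And>s. (\<And>n. range (s n) \<subseteq> topspace X) \<Longrightarrow> (\<And>n. limitin X (s n) (x (r n)) sequentially) \<Longrightarrow>
       \<exists>k::nat \<Rightarrow> nat. compactin X (X closure_of {s n j |n j. k n \<le> j})"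
proof -
  have "\<exists>r::nat \<Rightarrow> nat. strict_mono r \<and>
           (\<forall>s::nat \<Rightarrow> nat \<Rightarrow> 'b.
              (\<forall>n. range (s n) \<subseteq> topspace X \<and> limitin X (s n) (x (r n)) sequentially) \<longrightarrow>
              (\<exists>k::nat \<Rightarrow> nat. compactin X (X closure_of {s n j | n j. k n \<le> j})))"
    using a[unfolded property_a_def, rule_format, of x x0] x limitin_topspace[OF x(3)] by simp
  then show thesis
    using that by auto
qed

text \<open>If no \<open>n\<close> works, there are infinitely many points of \<open>E\<close> in \<open>q ` K m\<close>, each of which is a limit of
sequences leaving larger and larger \<open>q ` K n\<close>. Passing to a convergent subsequence contradicts
property (a), because a compact closure would lie in a single \<open>q ` K n\<close>.\<close>

lemma uniform_compact_type:
  assumes E: "\<And>x. x \<in> E \<Longrightarrow> compact_type_point X x" and a: "property_a X E"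
  shows "\<exists>n. E \<inter> q ` K m \<subseteq> seq_interior_K n"
proof (rule ccontr)
  assume "\<not> ?thesis"
  then have esc: "\<exists>x. x \<in> E \<inter> q ` K m \<and> x \<notin> seq_interior_K n" for n
    by blast
  \<comment> \<open>Increasing \<open>M\<close> along the chosen sequence makes its terms distinct, as property (a) demands.\<close>
  define M where "M x = (LEAST n. x \<in> seq_interior_K n)" for x
  have M: "x \<in> seq_interior_K (M x)" if "x \<in> E" for x
    unfolding M_def using compact_type_point_in_seq_interior_K[OF E[OF that]] by (auto intro: LeastI)
  have M_gt: "n < M x" if "x \<in> E" "x \<notin> seq_interior_K n" for n x
    using M[OF that(1)] that(2) seq_interior_K_mono[of "M x" n] by (meson not_le subsetD)
  have "\<exists>x. \<forall>n. (x n \<in> E \<inter> q ` K m \<and> x n \<notin> seq_interior_K n) \<and> M (x n) < M (x (Suc n))"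
  proof (rule dependent_nat_choice[where Q = "\<lambda>n a b. M a < M b"])
    show "\<exists>x. x \<in> E \<inter> q ` K m \<and> x \<notin> seq_interior_K 0"
      by (rule esc)
    fix x n
    obtain b where b: "b \<in> E \<inter> q ` K m" "b \<notin> seq_interior_K (max (Suc n) (M x))"
      using esc by blast
    have "b \<notin> seq_interior_K (Suc n)"
      using b(2) seq_interior_K_mono[of "Suc n" "max (Suc n) (M x)"] by auto
    moreover have "M x < M b"
      using M_gt[of b "max (Suc n) (M x)"] b by auto
    ultimately show "\<exists>y. (y \<in> E \<inter> q ` K m \<and> y \<notin> seq_interior_K (Suc n)) \<and> M x < M y"
      using b by blast
  qed
  then obtain x where xE: "\<And>n. x n \<in> E" and xK: "\<And>n. x n \<in> q ` K m" and xi: "\<And>n. x n \<notin> seq_interior_K n"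
      and xM: "\<And>n. M (x n) < M (x (Suc n))"
    by blast
  have "strict_mono (\<lambda>n. M (x n))"
    using xM by (simp add: strict_mono_Suc_iff)
  then have "inj (\<lambda>n. M (x n))"
    by (rule strict_mono_imp_inj_on)
  then have inj: "inj x"
    by (auto simp: inj_def)
  obtain r y l where r: "strict_mono (r::nat \<Rightarrow> nat)" and l: "limitin Y y l sequentially"
      and y: "\<forall>k. q (y k) = x (r k)"
    using convergent_subsequence_in_qK[of x m] xK by blast
  have lim: "limitin X (x \<circ> r) (q l) sequentially"
    using limitin_q[OF l] y by (simp add: o_def)
  have "inj (x \<circ> r)"
    using inj r by (simp add: inj_compose strict_mono_imp_inj_on)
  moreover have "range (x \<circ> r) \<subseteq> E"
    using xE by auto
  ultimately obtain r2 where r2: "strict_mono (r2::nat \<Rightarrow> nat)"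
    and cpt: "\<And>s. (\<And>n. range (s n) \<subseteq> topspace X) \<Longrightarrow>
          (\<And>n. limitin X (s n) ((x \<circ> r) (r2 n)) sequentially) \<Longrightarrow>
          \<exists>k::nat \<Rightarrow> nat. compactin X (X closure_of {s n j |n j. k n \<le> j})"
    using property_aE[OF a _ _ lim] by blast
  have "\<exists>s. range s \<subseteq> topspace X - q ` K n \<and> limitin X s (x (r (r2 n))) sequentially" for n
  proof -
    let ?i = "r (r2 n)"
    have "n \<le> ?i"
      using seq_suble[OF r] seq_suble[OF r2] order_trans by blast
    have "x ?i \<in> topspace X"
      using xK qK_subset by blast
    then have "x ?i \<in> seq_closure X (topspace X - q ` K ?i)"
      using xi[of ?i] by (simp add: seq_interior_K_def)
    then have "x ?i \<in> seq_closure X (topspace X - q ` K n)"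
      using seq_closure_mono[OF Diff_mono[OF order_refl qK_mono[OF \<open>n \<le> ?i\<close>]]] by blast
    then show ?thesis
      unfolding seq_closure_def by blast
  qed
  then obtain s where s: "\<And>n. range (s n) \<subseteq> topspace X - q ` K n"
      "\<And>n. limitin X (s n) (x (r (r2 n))) sequentially"
    by metis
  then obtain k where k: "compactin X (X closure_of {s n j |n j. k n \<le> (j::nat)})"
    using cpt[of s] by fastforce
  then obtain N where N: "X closure_of {s n j |n j. k n \<le> j} \<subseteq> q ` K N"
    using compactin_subset_some_qK by blast
  have "{s n j |n j. k n \<le> j} \<subseteq> X closure_of {s n j |n j. k n \<le> j}"
    by (rule closure_of_subset) (use s(1) in blast)
  moreover have "s N (k N) \<in> {s n j |n j. k n \<le> j}"
    by blast
  ultimately have "s N (k N) \<in> q ` K N"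
    using N by blast
  then show False
    using s(1)[of N] by blast
qed

lemma property_bE:
  assumes b: "property_b X E" and x: "inj x" "range x \<subseteq> topspace X" "limitin X x x0 sequentially"
  obtains r s where "strict_mono (r::nat \<Rightarrow> nat)" "\<And>n::nat. range (s n) \<subseteq> E"
    "\<And>n. limitin X (s n) (x (r n)) sequentially"
    "\<And>J::nat \<Rightarrow> nat. limitin X (\<lambda>n. s n (J n)) x0 sequentially"
proof -
  have "\<exists>(r::nat \<Rightarrow> nat) s. strict_mono r \<and>
           (\<forall>n. range (s n) \<subseteq> E \<and> limitin X (s n) (x (r n)) sequentially) \<and>
           (\<forall>J::nat \<Rightarrow> nat. limitin X (\<lambda>n. s n (J n)) x0 sequentially)"
    using b[unfolded property_b_def, rule_format, of x x0] x limitin_topspace[OF x(3)] by simp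
  then show thesis
    using that by blast
qed

text \<open>Property (b) replaces a sequence that approaches \<open>e\<close> off a closed set \<open>D\<close> by one in \<open>E\<close> with the same
behaviour: \<open>D\<close> is closed, so a diagonal can be chosen off \<open>D\<close>.\<close>

lemma property_b_approximation_off_closed_set:
  assumes b: "property_b X E" and x: "limitin X x e sequentially" "range x \<subseteq> topspace X"
    and D: "closedin X D" and xD: "\<And>n. x n \<notin> D" and e: "e \<in> D"
  shows "\<exists>d. range d \<subseteq> E - D \<and> limitin X d e sequentially"
proof -
  have ne: "x n \<noteq> e" for n
    using xD e by blast
  obtain r where r: "strict_mono (r::nat \<Rightarrow> nat)" "inj (x \<circ> r)"
    using inj_subsequence_of_punctured_limit[OF t1_X x(1) ne x(2)] by blast
  have "range (x \<circ> r) \<subseteq> topspace X" "limitin X (x \<circ> r) e sequentially"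
    using x limitin_subsequence[OF r(1)] by auto
  then obtain r2 s where sE: "\<And>n::nat. range (s n) \<subseteq> E"
      and s: "\<And>n. limitin X (s n) ((x \<circ> r) (r2 n)) sequentially"
      and diag: "\<And>J::nat \<Rightarrow> nat. limitin X (\<lambda>n. s n (J n)) e sequentially"
    using property_bE[OF b r(2)] by metis
  have "\<exists>j. s n j \<notin> D" for n
  proof -
    have "openin X (topspace X - D)" "(x \<circ> r) (r2 n) \<in> topspace X - D"
      using D xD x(2) by auto
    then have "\<forall>\<^sub>F j in sequentially. s n j \<in> topspace X - D"
      by (rule limitinD[OF s])
    then show ?thesis
      by (auto simp: eventually_sequentially)
  qed
  then obtain J where J: "\<And>n. s n (J n) \<notin> D"
    by metis
  have "range (\<lambda>n. s n (J n)) \<subseteq> E - D"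
    using J sE by blast
  then show ?thesis
    using diag by blast
qed

text \<open>The hypothesis on \<open>p\<close> yields a neighbourhood \<open>G\<close> of \<open>p\<close> with \<open>G \<inter> q ` K m' \<subseteq> q ` K m\<close>, and the Baire
category theorem is applied to the locally compact Hausdorff space \<open>A \<inter> G\<close>, where \<open>A\<close> is the closure
of \<open>E \<inter> G \<inter> q ` K m\<close>. The sets \<open>N k\<close> contain the points of \<open>A \<inter> G\<close> that are limits of sequences in
\<open>q ` K k\<close> outside \<open>q ` K m'\<close>; the sets \<open>M i\<close> contain those at which the \<open>i\<close>-th basic set violates
continuity within \<open>q ` K m'\<close>. A point outside all of them is a continuity point.

The sets are nowhere dense because the dense subset \<open>E \<inter> G \<inter> q ` K m\<close> of \<open>A \<inter> G\<close> lies in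
\<open>seq_interior_K m'\<close>: it avoids \<open>N k\<close>, and a point of it in \<open>M i\<close> is approached, by property (b), by
points of \<open>E\<close> outside the closed set \<open>D i\<close>. These lie in \<open>q ` K m'\<close> eventually, hence, by the choice
of \<open>G\<close>, in \<open>q ` K m\<close>, so they belong to \<open>A \<inter> G\<close> again.\<close>

lemma continuity_points_dense_near:
  assumes E: "E \<subseteq> topspace X" and b: "property_b X E"
    and p: "p \<in> E" "p \<in> seq_interior_K m" and uni: "E \<inter> q ` K m \<subseteq> seq_interior_K m'"
  shows "p \<in> X closure_of (continuity_points \<inter> q ` K m)"
  unfolding in_closure_of
proof (intro conjI allI impI)
  show "p \<in> topspace X"
    using p E by blast
  fix W assume "p \<in> W \<and> openin X W"
  then have W: "p \<in> W" "openin X W"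
    by auto
  have pK: "p \<in> q ` K m"
    using eventually_in_qK[OF p(2), of "\<lambda>_. p"] \<open>p \<in> topspace X\<close> by simp
  \<comment> \<open>\<open>W\<close> is shrunk so that near \<open>p\<close> nothing of \<open>q ` K m'\<close> is left outside \<open>q ` K m\<close>.\<close>
  define G where "G = W - X closure_of (q ` K m' - q ` K m)"
  have G: "openin X G" "p \<in> G"
    using W seq_interior_K_notin_closure[OF p(2)] by (auto simp: G_def openin_diff)
  have GK: "x \<in> q ` K m" if "x \<in> G" "x \<in> q ` K m'" for x
  proof (rule ccontr)
    assume "x \<notin> q ` K m"
    then have "x \<in> X closure_of (q ` K m' - q ` K m)"
      using that qK_subset by (intro set_mp[OF closure_of_subset]) auto
    then show False
      using that(1) by (simp add: G_def)
  qed
  define A where "A = X closure_of (E \<inter> G \<inter> q ` K m)"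
  define Z where "Z = subtopology X (A \<inter> G)"
  have AK: "A \<subseteq> q ` K m"
    unfolding A_def by (intro closure_of_minimal closedin_q_image compactin_K) auto
  have EA: "E \<inter> G \<inter> q ` K m \<subseteq> A"
    unfolding A_def using E by (intro closure_of_subset) auto
  have topZ: "topspace Z = A \<inter> G"
    using AK qK_subset by (auto simp: Z_def)
  have cptA: "compact_space (subtopology X A)"
    using closed_compactin[OF compactin_q_image[OF compactin_K] AK] by (simp add: A_def compact_space_subtopology)
  have hausA: "Hausdorff_space (subtopology X A)"
    using Hausdorff_X by (rule Hausdorff_space_subtopology)
  have "locally_compact_space (subtopology (subtopology X A) (A \<inter> G))"
    using hausA cptA G(1)
    by (intro locally_compact_space_open_subset compact_imp_locally_compact_space) (auto simp: openin_subtopology_Int2)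
  then have lcZ: "locally_compact_space Z"
    by (simp add: Z_def subtopology_subtopology inf.absorb2)
  have "Hausdorff_space Z"
    unfolding Z_def using Hausdorff_X by (rule Hausdorff_space_subtopology)
  then have regZ: "regular_space Z"
    using lcZ locally_compact_Hausdorff_imp_regular_space by blast
  have thin: "closedin Z (A \<inter> G \<inter> F) \<and> Z interior_of (A \<inter> G \<inter> F) = {}"
    if F: "closedin X F"
      and esc: "\<And>e H. openin X H \<Longrightarrow> H \<subseteq> G \<Longrightarrow> e \<in> E \<inter> H \<inter> q ` K m \<Longrightarrow> \<exists>f \<in> E \<inter> H \<inter> q ` K m. f \<notin> F" for F
  proof
    show "closedin Z (A \<inter> G \<inter> F)"
      unfolding Z_def using F by (auto simp: closedin_subtopology)
    show "Z interior_of (A \<inter> G \<inter> F) = {}"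
    proof (rule ccontr)
      assume "\<not> ?thesis"
      then obtain T z where T: "openin Z T" "z \<in> T" "T \<subseteq> A \<inter> G \<inter> F"
        unfolding interior_of_def by blast
      then obtain H where H: "openin X H" "T = H \<inter> (A \<inter> G)"
        unfolding Z_def openin_subtopology by blast
      have "openin X (H \<inter> G)" "z \<in> H \<inter> G" "z \<in> A"
        using H T G by auto
      then obtain e where "e \<in> E \<inter> G \<inter> q ` K m" "e \<in> H \<inter> G"
        unfolding A_def in_closure_of by blast
      then obtain f where f: "f \<in> E \<inter> (H \<inter> G) \<inter> q ` K m" "f \<notin> F"
        using esc[OF \<open>openin X (H \<inter> G)\<close>, of e] by blast
      then have "f \<in> T"
        using H EA by blast
      then show False
        using T f by blast
    qed
  qed
  define N where "N k = A \<inter> G \<inter> X closure_of (q ` K k - q ` K m')" for k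
  define D where "D i = q ` (Y closure_of U i)" for i
  define M where "M i = A \<inter> G \<inter> (D i \<inter> X closure_of (q ` K m' - D i))" for i
  have D: "closedin X (D i)" for i
    unfolding D_def by (intro closedin_q_image compactin_closure_U)
  have thinN: "closedin Z (N k) \<and> Z interior_of (N k) = {}" for k
    unfolding N_def
  proof (rule thin)
    fix e H assume "e \<in> E \<inter> H \<inter> q ` K m"
    then show "\<exists>f \<in> E \<inter> H \<inter> q ` K m. f \<notin> X closure_of (q ` K k - q ` K m')"
      using uni seq_interior_K_notin_closure by blast
  qed simp
  have thinM: "closedin Z (M i) \<and> Z interior_of (M i) = {}" for i
    unfolding M_def
  proof (rule thin)
    show "closedin X (D i \<inter> X closure_of (q ` K m' - D i))"
      using D by (intro closedin_Int) auto
    fix e H assume H: "openin X H" "H \<subseteq> G" and e: "e \<in> E \<inter> H \<inter> q ` K m"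
    show "\<exists>f \<in> E \<inter> H \<inter> q ` K m. f \<notin> D i \<inter> X closure_of (q ` K m' - D i)"
    proof (cases "e \<in> D i \<inter> X closure_of (q ` K m' - D i)")
      case False
      then show ?thesis
        using e by blast
    next
      case True
      then have eD: "e \<in> D i" and "e \<in> seq_closure X (q ` K m' - D i)"
        using closure_eq_seq_closure_in_qK[of "q ` K m' - D i" m' e] by auto
      then obtain x where x: "range x \<subseteq> q ` K m' - D i" "limitin X x e sequentially"
        unfolding seq_closure_def by blast
      have xX: "range x \<subseteq> topspace X" and xD: "\<And>n. x n \<notin> D i"
        using x(1) qK_subset by blast+
      obtain d where d: "range d \<subseteq> E - D i" "limitin X d e sequentially"
        using property_b_approximation_off_closed_set[OF b x(2) xX D xD eD] by blast
      have "e \<in> seq_interior_K m'" "range d \<subseteq> topspace X" "e \<in> H"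
        using e uni d(1) E by blast+
      then have "\<forall>\<^sub>F n in sequentially. d n \<in> q ` K m' \<and> d n \<in> H"
        using eventually_in_qK[of e m' d] limitinD[OF d(2) H(1)] d(2) by (simp add: eventually_conj)
      then obtain n where "d n \<in> q ` K m'" "d n \<in> H"
        unfolding eventually_sequentially by blast
      then have "d n \<in> E \<inter> H \<inter> q ` K m" "d n \<notin> D i"
        using d(1) GK H(2) by blast+
      then show ?thesis
        by blast
    qed
  qed
  have "Z interior_of \<Union>(range N \<union> range M) = {}"
    using lcZ regZ thinN thinM by (intro Baire_category_alt) auto
  moreover have "p \<in> topspace Z"
    using topZ EA p(1) G(2) pK by blast
  ultimately have "\<not> topspace Z \<subseteq> \<Union>(range N \<union> range M)"
    by (metis (no_types, lifting) empty_iff interior_of_mono interior_of_topspace subsetD)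
  then obtain t where tZ: "t \<in> topspace Z" and tNM: "t \<notin> \<Union>(range N \<union> range M)"
    by blast
  have t: "t \<in> A" "t \<in> G"
    using tZ by (simp_all add: topZ)
  have tN: "t \<notin> N k" and tM: "t \<notin> M i" for k i
    using tNM by simp_all
  have tK: "t \<in> q ` K m"
    using t AK by blast
  have "t \<in> continuity_points"
  proof (rule continuity_pointsI)
    show "t \<in> topspace X"
      using tK qK_subset by blast
    fix i assume i: "t \<in> q ` (Y closure_of U i)"
    show "t \<notin> seq_closure X (topspace X - q ` (Y closure_of U i))"
    proof
      assume "t \<in> seq_closure X (topspace X - q ` (Y closure_of U i))"
      then obtain s where s: "range s \<subseteq> topspace X - D i" "limitin X s t sequentially"
        unfolding seq_closure_def D_def by blast
      then obtain k where k: "range s \<subseteq> q ` K k"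
        using convergent_sequence_in_some_qK by blast
      have "\<forall>\<^sub>F n in sequentially. s n \<in> q ` K m'"
      proof (rule ccontr)
        assume "\<not> ?thesis"
        then obtain r where r: "strict_mono (r::nat \<Rightarrow> nat)" "\<And>n. s (r n) \<notin> q ` K m'"
          using not_eventually_imp_strict_mono_choice[of "\<lambda>n. s n \<in> q ` K m'"] by blast
        have "range (s \<circ> r) \<subseteq> q ` K k - q ` K m'"
          using r(2) k by auto
        then have "t \<in> X closure_of (q ` K k - q ` K m')"
          by (rule set_mp[OF seq_closure_subset_closure seq_closureI[OF _ limitin_subsequence[OF r(1) s(2)]]])
        then show False
          using tN[of k] t by (simp add: N_def)
      qed
      then obtain n0 where n0: "\<And>n. n \<ge> n0 \<Longrightarrow> s n \<in> q ` K m'"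
        by (auto simp: eventually_sequentially)
      have "t \<in> X closure_of (q ` K m' - D i)"
      proof (rule set_mp[OF seq_closure_subset_closure seq_closureI])
        show "range (\<lambda>n. s (n + n0)) \<subseteq> q ` K m' - D i"
          using n0 s(1) by auto
        show "limitin X (\<lambda>n. s (n + n0)) t sequentially"
          by (rule limitin_sequentially_offset[OF s(2)])
      qed
      then show False
        using tM[of i] t i by (simp add: M_def D_def)
    qed
  qed
  moreover have "t \<in> W"
    using t(2) by (simp add: G_def)
  ultimately show "\<exists>y. y \<in> continuity_points \<inter> q ` K m \<and> y \<in> W"
    using tK by blast
qed

lemma compactin_core_K: "compactin Y (core \<inter> K n)"
  by (rule closed_Int_compactin[OF closedin_core compactin_K])

text \<open>The uniformity lemma is used twice: once to place \<open>E \<inter> q ` K k\<close> in a sequential interior, and once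
to supply the \<open>m'\<close> of the density lemma.\<close>

lemma compact_type_points_covered_by_core:
  assumes E: "\<And>x. x \<in> E \<Longrightarrow> compact_type_point X x" and a: "property_a X E" and b: "property_b X E"
  shows "\<exists>m. E \<inter> q ` K k \<subseteq> q ` (core \<inter> K m)"
proof -
  have EX: "E \<subseteq> topspace X"
    using E by (auto simp: compact_type_point_def)
  obtain m where m: "E \<inter> q ` K k \<subseteq> seq_interior_K m"
    using uniform_compact_type[OF E a] by blast
  obtain m' where m': "E \<inter> q ` K m \<subseteq> seq_interior_K m'"
    using uniform_compact_type[OF E a] by blast
  have "continuity_points \<inter> q ` K m \<subseteq> q ` (core \<inter> K m)"
  proof
    fix x assume x: "x \<in> continuity_points \<inter> q ` K m"
    then obtain y where y: "y \<in> K m" "q y = x"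
      by blast
    then have "y \<in> core"
      unfolding core_def using x K_subset by (intro set_mp[OF closure_of_subset]) auto
    then show "x \<in> q ` (core \<inter> K m)"
      using y by blast
  qed
  then have "X closure_of (continuity_points \<inter> q ` K m) \<subseteq> q ` (core \<inter> K m)"
    by (rule closure_of_minimal[OF _ closedin_q_image[OF compactin_core_K]])
  then have "E \<inter> q ` K k \<subseteq> q ` (core \<inter> K m)"
    using continuity_points_dense_near[OF EX b _ _ m'] m by blast
  then show ?thesis ..
qed

text \<open>Suppose that \<open>C\<close> has a closed preimage in the core but not in \<open>Y\<close>; then some \<open>x n \<in> C\<close> converge to a
point \<open>q y \<notin> C\<close>. The sets \<open>q ` (A \<inter> K m)\<close>, with \<open>A\<close> the preimage of \<open>C\<close> in the core, are closed and
miss \<open>q y\<close>, so a subsequence of \<open>x\<close> has its \<open>n\<close>-th term outside \<open>q ` (core \<inter> K n)\<close>. Property (b)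
then gives a diagonal sequence in \<open>E\<close> which converges and whose \<open>n\<close>-th term still avoids
\<open>q ` (core \<inter> K n)\<close>. But it lies in one \<open>q ` K k\<close>, and \<open>E \<inter> q ` K k\<close> is covered by one such image.\<close>

lemma core_quotient:
  assumes dense: "sequentially_dense X E" and E: "\<And>x. x \<in> E \<Longrightarrow> compact_type_point X x"
    and a: "property_a X E" and b: "property_b X E"
  shows "quotient_map (subtopology Y core) X q"
  unfolding quotient_map_closedin
proof (intro conjI allI impI)
  have EX: "E \<subseteq> topspace X"
    using dense by (simp add: sequentially_dense_def)
  have top: "topspace (subtopology Y core) = core"
    using core_subset by auto
  show "q ` topspace (subtopology Y core) = topspace X"
    unfolding top
  proof
    show "q ` core \<subseteq> topspace X"
      using core_subset q_in by blast
    show "topspace X \<subseteq> q ` core"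
    proof
      fix x assume "x \<in> topspace X"
      then obtain s where s: "range s \<subseteq> E" "limitin X s x sequentially"
        using dense unfolding sequentially_dense_def by blast
      then obtain k where "range s \<subseteq> q ` K k"
        using convergent_sequence_in_some_qK[OF subset_trans[OF s(1) EX] s(2)] by blast
      moreover obtain m where "E \<inter> q ` K k \<subseteq> q ` (core \<inter> K m)"
        using compact_type_points_covered_by_core[OF E a b] by blast
      ultimately have "range s \<subseteq> q ` (core \<inter> K m)"
        using s(1) by blast
      then have "x \<in> X closure_of (q ` (core \<inter> K m))"
        by (rule set_mp[OF seq_closure_subset_closure seq_closureI[OF _ s(2)]])
      then show "x \<in> q ` core"
        using closedin_q_image[OF compactin_core_K, of m] by (auto simp: closure_of_closedin)
    qed
  qed
  fix C assume CX: "C \<subseteq> topspace X"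
  define A where "A = {y \<in> core. q y \<in> C}"
  have "closedin X C" if A: "closedin Y A"
  proof -
    define P where "P = {y \<in> topspace Y. q y \<in> C}"
    have "Y closure_of P \<subseteq> P"
    proof
      fix y assume yP: "y \<in> Y closure_of P"
      then have yY: "y \<in> topspace Y"
        by (simp add: in_closure_of)
      obtain z where z: "range z \<subseteq> P" "limitin Y z y sequentially"
        using yP unfolding metrizable_closure_eq_seq_closure[OF metrizable] seq_closure_def by blast
      show "y \<in> P"
      proof (rule ccontr)
        assume "y \<notin> P"
        then have qy: "q y \<notin> C" "q y \<in> topspace X"
          using yY q_in by (auto simp: P_def)
        have zC: "q (z n) \<in> C" for n
          using z(1) by (auto simp: P_def)
        have lim: "limitin X (\<lambda>n. q (z n)) (q y) sequentially"
          by (rule limitin_q[OF z(2)])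
        have ne: "q (z n) \<noteq> q y" for n
          using zC[of n] qy by auto
        have ran: "range (\<lambda>n. q (z n)) \<subseteq> topspace X"
          using zC CX by blast
        obtain f where f: "strict_mono (f::nat \<Rightarrow> nat)" "inj ((\<lambda>n. q (z n)) \<circ> f)"
          using inj_subsequence_of_punctured_limit[OF t1_X lim ne ran] by blast
        define x where "x = (\<lambda>n. q (z (f n)))"
        have x: "limitin X x (q y) sequentially" "inj x" "\<And>n. x n \<in> C"
          using limitin_subsequence[OF f(1) lim] f(2) zC by (auto simp: x_def o_def)
        have "\<forall>\<^sub>F n in sequentially. x n \<notin> q ` (core \<inter> K m)" for m
        proof -
          have "closedin X (q ` (A \<inter> K m))"
            by (intro closedin_q_image closed_Int_compactin[OF A compactin_K])
          then have "openin X (topspace X - q ` (A \<inter> K m))" "q y \<in> topspace X - q ` (A \<inter> K m)"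
            using qy by (auto simp: A_def)
          then have "\<forall>\<^sub>F n in sequentially. x n \<in> topspace X - q ` (A \<inter> K m)"
            by (rule limitinD[OF x(1)])
          then show ?thesis
          proof (rule eventually_mono)
            fix n assume n: "x n \<in> topspace X - q ` (A \<inter> K m)"
            show "x n \<notin> q ` (core \<inter> K m)"
            proof
              assume "x n \<in> q ` (core \<inter> K m)"
              then obtain u where u: "u \<in> core" "u \<in> K m" "x n = q u"
                by blast
              then have "u \<in> A \<inter> K m"
                using x(3)[of n] by (simp add: A_def)
              then show False
                using n u(3) by blast
            qed
          qed
        qed
        then obtain g where g: "strict_mono (g::nat \<Rightarrow> nat)" "\<And>n. x (g n) \<notin> q ` (core \<inter> K n)"
          using eventually_imp_strict_mono_choice[of "\<lambda>m n. x n \<notin> q ` (core \<inter> K m)"] by blast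
        have xg: "inj (x \<circ> g)" "range (x \<circ> g) \<subseteq> topspace X" "limitin X (x \<circ> g) (q y) sequentially"
          using x CX limitin_subsequence[OF g(1) x(1)] g(1) by (auto simp: inj_compose strict_mono_imp_inj_on)
        obtain r s where r: "strict_mono (r::nat \<Rightarrow> nat)"
            and sE: "\<And>n::nat. range (s n) \<subseteq> E"
            and s: "\<And>n. limitin X (s n) ((x \<circ> g) (r n)) sequentially"
            and diag: "\<And>J::nat \<Rightarrow> nat. limitin X (\<lambda>n. s n (J n)) (q y) sequentially"
          by (rule property_bE[OF b xg]) (rule that)
        have "\<exists>j. s n j \<notin> q ` (core \<inter> K n)" for n
        proof (rule ccontr)
          assume "\<not> ?thesis"
          then have "range (s n) \<subseteq> q ` (core \<inter> K n)"
            by blast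
          then have "x (g (r n)) \<in> X closure_of (q ` (core \<inter> K n))"
            using s[of n] by (intro set_mp[OF seq_closure_subset_closure seq_closureI[of "s n"]]) auto
          then have "x (g (r n)) \<in> q ` (core \<inter> K n)"
            using closedin_q_image[OF compactin_core_K, of n] by (simp add: closure_of_closedin)
          then show False
            using g(2)[of "r n"] K_mono[OF seq_suble[OF r, of n]] by blast
        qed
        then obtain J where J: "\<And>n. s n (J n) \<notin> q ` (core \<inter> K n)"
          by metis
        obtain k where k: "range (\<lambda>n. s n (J n)) \<subseteq> q ` K k"
          using convergent_sequence_in_some_qK[OF _ diag[of J]] sE EX by blast
        obtain m where "E \<inter> q ` K k \<subseteq> q ` (core \<inter> K m)"
          using compact_type_points_covered_by_core[OF E a b] by blast
        then show False
          using J[of m] k sE[of m] by blast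
      qed
    qed
    then have "closedin Y P"
      by (metis (no_types, lifting) P_def closure_of_subset_eq mem_Collect_eq subsetI)
    then show ?thesis
      unfolding P_def using closedin_preimage_iff[OF CX] by simp
  qed
  moreover have "closedin Y A" if "closedin X C"
  proof -
    have "A = core \<inter> {y \<in> topspace Y. q y \<in> C}"
      using core_subset by (auto simp: A_def)
    then show ?thesis
      using closedin_Int[OF closedin_core closedin_continuous_map_preimage[OF continuous_q that]] by simp
  qed
  moreover have "closedin (subtopology Y core) A \<longleftrightarrow> closedin Y A"
    using closedin_closed_subtopology[OF closedin_core, of A] by (auto simp: A_def)
  ultimately show "closedin (subtopology Y core) {y \<in> topspace (subtopology Y core). q y \<in> C} \<longleftrightarrow> closedin X C"
    unfolding top A_def by blast
qed

end

section \<open>Compactness of the Fell topology\<close>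

lemma openin_fell_miss:
  "compactin Y C \<Longrightarrow> openin (fell_topology Y) {F. closedin Y F \<and> F \<inter> C = {}}"
  unfolding fell_topology_def by (intro topology_generated_by_Basis) blast

lemma openin_fell_hit:
  "openin Y W \<Longrightarrow> openin (fell_topology Y) {F. closedin Y F \<and> F \<inter> W \<noteq> {}}"
  unfolding fell_topology_def by (intro topology_generated_by_Basis) blast

text \<open>Alexander's subbase theorem, transferred to the inductive description of generated topologies.\<close>

lemma compact_space_topology_generated_by:
  assumes fin: "\<And>\<C>. \<C> \<subseteq> \<B> \<Longrightarrow> \<Union>\<C> = \<Union>\<B> \<Longrightarrow> \<exists>\<C>'. finite \<C>' \<and> \<C>' \<subseteq> \<C> \<and> \<Union>\<C>' = \<Union>\<B>"
  shows "compact_space (topology_generated_by \<B>)"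
proof -
  define T where "T = topology (arbitrary union_of (finite intersection_of (\<lambda>x. x \<in> \<B>) relative_to \<Union>\<B>))"
  have topT: "topspace T = \<Union>\<B>"
    unfolding T_def by (rule topspace_subbase)
  have "compact_space T"
  proof (rule Alexander_subbase[OF T_def[symmetric]])
    fix \<C> assume "\<C> \<subseteq> \<B>" "\<Union>\<C> = topspace T"
    then show "\<exists>\<C>'. finite \<C>' \<and> \<C>' \<subseteq> \<C> \<and> \<Union>\<C>' = topspace T"
      using fin topT by simp
  qed
  have coarser: "openin T W" if "generate_topology_on \<B> W" for W
    using that
  proof induction
    case (Basis s)
    have "s \<subseteq> \<Union>\<B>"
      using Basis by blast
    then have "((finite intersection_of (\<lambda>x. x \<in> \<B>)) relative_to \<Union>\<B>) s"
      using Basis by (metis (no_types, lifting) finite_intersection_of_inc inf.absorb2 relative_to_def)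
    then show ?case
      unfolding T_def openin_subbase by (rule union_of_inc[rotated]) (auto simp: arbitrary_def)
  qed auto
  show ?thesis
    unfolding compact_space_alt
  proof (intro allI impI, elim conjE)
    fix \<U> assume "\<forall>W\<in>\<U>. openin (topology_generated_by \<B>) W" "topspace (topology_generated_by \<B>) \<subseteq> \<Union>\<U>"
    then have "\<forall>W\<in>\<U>. openin T W" "topspace T \<subseteq> \<Union>\<U>"
      using coarser topT by (auto simp: openin_topology_generated_by_iff)
    then show "\<exists>\<F>. finite \<F> \<and> \<F> \<subseteq> \<U> \<and> topspace (topology_generated_by \<B>) \<subseteq> \<Union>\<F>"
      using \<open>compact_space T\<close> topT unfolding compact_space_alt by simp
  qed
qed

text \<open>Given a subbasic cover, let \<open>F0\<close> be the complement of all open sets \<open>W\<close> whose hit sets are in the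
cover. No hit set of the cover contains \<open>F0\<close>, so some miss set does, for a compact \<open>C\<close> that is then covered by
the \<open>W\<close>. Finitely many of them suffice, and together with the miss set of \<open>C\<close> their hit sets cover.\<close>

lemma compact_space_fell_topology: "compact_space (fell_topology Y)"
  unfolding fell_topology_def
proof (rule compact_space_topology_generated_by)
  let ?miss = "\<lambda>C. {F. closedin Y F \<and> F \<inter> C = {}}"
  let ?hit = "\<lambda>W. {F. closedin Y F \<and> F \<inter> W \<noteq> {}}"
  let ?\<B> = "{?miss C |C. compactin Y C} \<union> {?hit W |W. openin Y W}"
  have UB: "\<Union>?\<B> = {F. closedin Y F}"
    using topspace_fell_topology[of Y] unfolding fell_topology_def topology_generated_by_topspace .
  fix \<C> assume sub: "\<C> \<subseteq> ?\<B>" and cov: "\<Union>\<C> = \<Union>?\<B>"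
  define \<W> where "\<W> = {W. openin Y W \<and> ?hit W \<in> \<C>}"
  define F0 where "F0 = topspace Y - \<Union>\<W>"
  have "closedin Y F0"
    unfolding F0_def by (intro closedin_diff openin_Union) (auto simp: \<W>_def)
  then have "F0 \<in> \<Union>\<C>"
    unfolding cov UB by simp
  then obtain c where c: "c \<in> \<C>" "F0 \<in> c"
    by blast
  have not_hit: "c \<noteq> ?hit W" if "openin Y W" for W
  proof
    assume "c = ?hit W"
    then have "W \<in> \<W>" "F0 \<inter> W \<noteq> {}"
      using c that by (auto simp: \<W>_def)
    then show False
      by (auto simp: F0_def)
  qed
  have "c \<in> ?\<B>"
    using sub c(1) by (rule subsetD)
  then obtain C where C: "compactin Y C" "c = ?miss C"
  proof (elim UnE CollectE exE conjE)
    fix W assume "c = ?hit W" "openin Y W"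
    then show thesis
      using not_hit by simp
  qed (rule that)
  have "C \<subseteq> \<Union>\<W>"
    using c C compactin_subset_topspace[OF C(1)] by (auto simp: F0_def)
  moreover have "\<forall>W\<in>\<W>. openin Y W"
    by (simp add: \<W>_def)
  ultimately obtain \<F> where \<F>: "finite \<F>" "\<F> \<subseteq> \<W>" "C \<subseteq> \<Union>\<F>"
    using C(1) unfolding compactin_def by meson
  have "\<Union>(insert c (?hit ` \<F>)) = {F. closedin Y F}"
  proof
    show "\<Union>(insert c (?hit ` \<F>)) \<subseteq> {F. closedin Y F}"
      using C by auto
    show "{F. closedin Y F} \<subseteq> \<Union>(insert c (?hit ` \<F>))"
    proof
      fix F assume F: "F \<in> {F. closedin Y F}"
      show "F \<in> \<Union>(insert c (?hit ` \<F>))"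
      proof (cases "F \<inter> C = {}")
        case True
        then show ?thesis
          using C F by simp
      next
        case False
        then obtain W where "W \<in> \<F>" "F \<inter> W \<noteq> {}"
          using \<F>(3) by blast
        then show ?thesis
          using F by auto
      qed
    qed
  qed
  moreover have "insert c (?hit ` \<F>) \<subseteq> \<C>"
    using c \<F>(2) by (auto simp: \<W>_def)
  ultimately show "\<exists>\<C>'. finite \<C>' \<and> \<C>' \<subseteq> \<C> \<and> \<Union>\<C>' = \<Union>?\<B>"
    unfolding UB using \<F>(1) by (intro exI[of _ "insert c (?hit ` \<F>)"]) simp
qed

lemma compact_space_sequence_cluster_point:
  assumes cpt: "compact_space T" and v: "range v \<subseteq> topspace T"
  shows "\<exists>g \<in> topspace T. \<forall>N. openin T N \<and> g \<in> N \<longrightarrow> (\<forall>m::nat. \<exists>n\<ge>m. v n \<in> N)"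
proof (rule ccontr)
  assume "\<not> ?thesis"
  then have "\<forall>g \<in> topspace T. \<exists>N. openin T N \<and> g \<in> N \<and> (\<exists>m. \<forall>n\<ge>m. v n \<notin> N)"
    by simp
  from bchoice[OF this] obtain N where
    N: "\<forall>g \<in> topspace T. openin T (N g) \<and> g \<in> N g \<and> (\<exists>m. \<forall>n\<ge>m. v n \<notin> N g)"
    by (elim exE)
  have "\<forall>W\<in>N ` topspace T. openin T W" "topspace T \<subseteq> \<Union>(N ` topspace T)"
    using N by blast+
  then obtain \<F> where \<F>: "finite \<F>" "\<F> \<subseteq> N ` topspace T" "topspace T \<subseteq> \<Union>\<F>"
    using cpt unfolding compact_space_alt by meson
  have "\<forall>\<^sub>F n in sequentially. v n \<notin> N g" if "g \<in> topspace T" for g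
    using N that unfolding eventually_sequentially by simp
  then have "\<forall>W\<in>\<F>. \<forall>\<^sub>F n in sequentially. v n \<notin> W"
    using \<F>(2) by auto
  then have "\<forall>\<^sub>F n in sequentially. \<forall>W\<in>\<F>. v n \<notin> W"
    using \<F>(1) by (simp add: eventually_ball_finite)
  then obtain n where "\<forall>W\<in>\<F>. v n \<notin> W"
    by (auto simp: eventually_sequentially)
  then show False
    using \<F>(3) v by blast
qed

section \<open>Limits of fibres\<close>

context standard_quotient
begin

abbreviation Ystar :: "'a set topology" where
  "Ystar \<equiv> Y_star Y X q"

definition fibre :: "'b \<Rightarrow> 'a set" where
  "fibre x = {y \<in> topspace Y. q y = x}"

lemma fibres_eq: "fibres Y X q = fibre ` topspace X"
  unfolding fibres_def fibre_def by blast

lemma in_Ystar_iff: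
  "F \<in> topspace Ystar \<longleftrightarrow> F \<in> fell_topology Y closure_of fibres Y X q \<and> F \<noteq> {}"
  unfolding Y_star_def by (auto simp: in_closure_of)

lemma closedin_of_Ystar: "F \<in> topspace Ystar \<Longrightarrow> closedin Y F"
  by (auto simp: in_Ystar_iff in_closure_of topspace_fell_topology)

lemma q_eq_q_star: "F \<in> topspace Ystar \<Longrightarrow> y \<in> F \<Longrightarrow> q y = q_star q F"
  using q_star_eq[OF quotient Hausdorff_X] by simp

lemma q_star_in: "F \<in> topspace Ystar \<Longrightarrow> q_star q F \<in> topspace X"
  using q_eq_q_star closedin_of_Ystar closedin_subset q_in by (metis equals0I in_Ystar_iff subsetD)

lemma Ystar_subset_fibre: "F \<in> topspace Ystar \<Longrightarrow> F \<subseteq> fibre (q_star q F)"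
  using q_eq_q_star closedin_subset[OF closedin_of_Ystar] unfolding fibre_def by blast

lemma fibre_in_Ystar:
  assumes x: "x \<in> topspace X"
  shows "fibre x \<in> topspace Ystar" "q_star q (fibre x) = x"
proof -
  obtain y where y: "y \<in> fibre x"
    using q_lift[OF x] by (auto simp: fibre_def)
  have "closedin Y (fibre z)" if z: "z \<in> topspace X" for z
  proof -
    have "closedin X {z}"
      using t1_X z by (simp add: closedin_t1_singleton)
    then show ?thesis
      using closedin_continuous_map_preimage[OF continuous_q, of "{z}"] by (simp add: fibre_def)
  qed
  then have "fibres Y X q \<subseteq> topspace (fell_topology Y)"
    by (auto simp: fibres_eq topspace_fell_topology)
  then have "fibre x \<in> fell_topology Y closure_of fibres Y X q"
    by (rule set_mp[OF closure_of_subset]) (use x in \<open>simp add: fibres_eq\<close>)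
  then show *: "fibre x \<in> topspace Ystar"
    using y by (auto simp: in_Ystar_iff)
  show "q_star q (fibre x) = x"
    using q_eq_q_star[OF * y] y by (simp add: fibre_def)
qed

lemma openin_YstarI: "openin (fell_topology Y) N \<Longrightarrow> openin Ystar (topspace Ystar \<inter> N)"
proof -
  assume N: "openin (fell_topology Y) N"
  have "topspace Ystar \<inter> N = N \<inter> (fell_topology Y closure_of fibres Y X q - {{}})"
    using in_Ystar_iff by auto
  then show ?thesis
    using N unfolding Y_star_def openin_subtopology by auto
qed

lemma closedin_Ystar_miss:
  assumes "openin Y W"
  shows "closedin Ystar {F \<in> topspace Ystar. F \<inter> W = {}}"
proof -
  have "topspace Ystar - {F \<in> topspace Ystar. F \<inter> W = {}}
      = topspace Ystar \<inter> {F. closedin Y F \<and> F \<inter> W \<noteq> {}}"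
    using closedin_of_Ystar by auto
  then show ?thesis
    using openin_YstarI[OF openin_fell_hit[OF assms]] by (simp add: closedin_def)
qed

text \<open>The Fell topology is compact, so \<open>v\<close> has a cluster point; the convergent selection \<open>y\<close> guarantees
that this cluster point contains \<open>l\<close>, and in particular is not the empty set removed from \<open>Y\<^sub>*\<close>.
The last clause expresses clustering in the form in which it is used.\<close>

lemma Ystar_cluster_point:
  assumes v: "range v \<subseteq> topspace Ystar" and y: "\<And>n. y n \<in> v n" and lim: "limitin Y y l sequentially"
  shows "\<exists>G \<in> topspace Ystar. l \<in> G \<and> (\<forall>A. closedin Ystar A \<and> range v \<subseteq> A \<longrightarrow> G \<in> A)"
proof -
  let ?cl = "fell_topology Y closure_of fibres Y X q"
  have vcl: "v n \<in> ?cl" for n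
    using v in_Ystar_iff by blast
  then have "range v \<subseteq> topspace (fell_topology Y)"
    by (auto simp: in_closure_of)
  then obtain G where G: "G \<in> topspace (fell_topology Y)"
    and cluster: "\<And>N m. openin (fell_topology Y) N \<Longrightarrow> G \<in> N \<Longrightarrow> \<exists>n\<ge>m. v n \<in> N"
    using compact_space_sequence_cluster_point[OF compact_space_fell_topology] by metis
  have clG: "closedin Y G"
    using G by (simp add: topspace_fell_topology)
  have lG: "l \<in> G"
  proof (rule ccontr)
    assume "l \<notin> G"
    then have "l \<in> topspace Y - G" "openin Y (topspace Y - G)"
      using limitin_topspace[OF lim] clG by auto
    then obtain i where i: "l \<in> U i" "Y closure_of U i \<subseteq> topspace Y - G"
      using base_U by blast
    then have "G \<in> {F. closedin Y F \<and> F \<inter> Y closure_of U i = {}}"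
      using clG by blast
    note N = cluster[OF openin_fell_miss[OF compactin_closure_U] this]
    obtain n0 where n0: "\<And>n. n \<ge> n0 \<Longrightarrow> y n \<in> U i"
      using limitinD[OF lim openin_U i(1)] by (auto simp: eventually_sequentially)
    obtain n where "n \<ge> n0" "v n \<inter> Y closure_of U i = {}"
      using N[of n0] by blast
    then show False
      using n0[of n] y[of n] U_subset_closure by blast
  qed
  have "G \<in> ?cl"
  proof (rule ccontr)
    assume "G \<notin> ?cl"
    then have "openin (fell_topology Y) (topspace (fell_topology Y) - ?cl)" "G \<in> topspace (fell_topology Y) - ?cl"
      using G by auto
    then show False
      using cluster vcl by blast
  qed
  then have GY: "G \<in> topspace Ystar"
    using lG in_Ystar_iff by blast
  moreover have "G \<in> A" if A: "closedin Ystar A" "range v \<subseteq> A" for A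
  proof (rule ccontr)
    assume "G \<notin> A"
    then have "openin Ystar (topspace Ystar - A)" "G \<in> topspace Ystar - A"
      using A GY by auto
    then obtain N where N: "openin (fell_topology Y) N" "topspace Ystar - A = N \<inter> (?cl - {{}})"
      unfolding Y_star_def openin_subtopology by blast
    then have "G \<in> N"
      using \<open>G \<in> topspace Ystar - A\<close> by blast
    then obtain n where "v n \<in> N"
      using cluster[OF N(1)] by blast
    moreover have "v n \<in> ?cl - {{}}"
      using v in_Ystar_iff by blast
    ultimately have "v n \<in> topspace Ystar - A"
      using N(2) by blast
    then show False
      using A(2) by blast
  qed
  ultimately show ?thesis
    using lG by blast
qed

abbreviation S :: "'a set set" where
  "S \<equiv> singleton_fibres Ystar (q_star q)"

text \<open>Let \<open>F\<close> in \<open>Y\<^sub>*\<close> lie over \<open>x\<close> and miss a point \<open>y\<close> of the fibre, and take a basic neighbourhood \<open>U i\<close>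
of \<open>y\<close> whose closure misses \<open>F\<close>. Fibres close to \<open>F\<close> miss \<open>U i\<close> but come close to any \<open>w \<in> F\<close>; their
base points give a sequence converging to \<open>x\<close> which contradicts continuity for \<open>U i\<close>.\<close>

lemma fibre_singleton_if_continuity_point:
  assumes x: "x \<in> continuity_points"
  shows "fibre x \<in> S"
proof -
  have xX: "x \<in> topspace X"
    using x continuity_points_subset by blast
  have uniq: "F = fibre x" if F: "F \<in> topspace Ystar" "q_star q F = x" for F
  proof (rule ccontr)
    assume "F \<noteq> fibre x"
    then obtain y where y: "y \<in> topspace Y" "q y = x" "y \<notin> F"
      using Ystar_subset_fibre[OF F(1)] F(2) by (auto simp: fibre_def)
    then have "openin Y (topspace Y - F)" "y \<in> topspace Y - F"
      using closedin_of_Ystar[OF F(1)] by auto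
    then obtain i where i: "y \<in> U i" "Y closure_of U i \<subseteq> topspace Y - F"
      using base_U by blast
    obtain w where w: "w \<in> F"
      using F(1) in_Ystar_iff by blast
    then have wY: "w \<in> topspace Y" and qw: "q w = x"
      using closedin_subset[OF closedin_of_Ystar[OF F(1)]] q_eq_q_star[OF F(1) w] F(2) by auto
    have "w \<in> Y closure_of {z \<in> topspace Y. q z \<notin> q ` U i}"
      unfolding in_closure_of
    proof (intro conjI allI impI wY)
      fix B assume B: "w \<in> B \<and> openin Y B"
      define N where "N = {F. closedin Y F \<and> F \<inter> B \<noteq> {}} \<inter> {F. closedin Y F \<and> F \<inter> Y closure_of U i = {}}"
      have "openin (fell_topology Y) N"
        unfolding N_def using B by (intro openin_Int openin_fell_hit openin_fell_miss compactin_closure_U) auto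
      moreover have "F \<in> N"
        using w B i(2) closedin_of_Ystar[OF F(1)] by (auto simp: N_def)
      ultimately obtain G where "G \<in> fibres Y X q" "G \<in> N"
        using F(1) unfolding in_Ystar_iff in_closure_of by blast
      then obtain x' z where xz: "z \<in> fibre x'" "z \<in> B" "fibre x' \<inter> Y closure_of U i = {}"
        by (auto simp: N_def fibres_eq)
      have "q z \<notin> q ` U i"
      proof
        assume "q z \<in> q ` U i"
        then obtain u where "u \<in> U i" "q u = q z"
          by force
        then have "u \<in> fibre x' \<inter> Y closure_of U i"
          using xz(1) openin_subset[OF openin_U] U_subset_closure by (auto simp: fibre_def)
        then show False
          using xz(3) by blast
      qed
      then show "\<exists>z. z \<in> {z \<in> topspace Y. q z \<notin> q ` U i} \<and> z \<in> B"
        using xz by (auto simp: fibre_def)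
    qed
    then obtain s where s: "range s \<subseteq> {z \<in> topspace Y. q z \<notin> q ` U i}" "limitin Y s w sequentially"
      unfolding metrizable_closure_eq_seq_closure[OF metrizable] seq_closure_def by blast
    have "s n \<in> topspace Y" "q (s n) \<notin> q ` U i" for n
      using s(1) by auto
    then have "range (\<lambda>n. q (s n)) \<subseteq> topspace X - q ` U i"
      by (simp add: image_subset_iff q_in)
    moreover have "limitin X (\<lambda>n. q (s n)) x sequentially"
      using limitin_q[OF s(2)] qw by simp
    ultimately have "x \<in> seq_closure X (topspace X - q ` U i)"
      by (rule seq_closureI)
    moreover have "x \<in> q ` U i"
      using i(1) y(2) by blast
    ultimately show False
      using x openin_U[of i] unfolding continuity_points_def by blast
  qed
  have "{w \<in> topspace Ystar. q_star q w = q_star q (fibre x)} = {fibre x}"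
  proof (intro equalityI subsetI)
    fix w assume "w \<in> {w \<in> topspace Ystar. q_star q w = q_star q (fibre x)}"
    then show "w \<in> {fibre x}"
      using uniq[of w] fibre_in_Ystar(2)[OF xX] by simp
  next
    fix w assume "w \<in> {fibre x}"
    then show "w \<in> {w \<in> topspace Ystar. q_star q w = q_star q (fibre x)}"
      using fibre_in_Ystar(1)[OF xX] by simp
  qed
  then show ?thesis
    using fibre_in_Ystar(1)[OF xX] by (simp add: singleton_fibres_def)
qed

text \<open>If continuity fails for \<open>W\<close>, then the fibres over some sequence converging to \<open>x\<close> miss \<open>W\<close>, and they
have a cluster point which lies over \<open>x\<close>, misses \<open>W\<close> and hence differs from the whole fibre.\<close>

lemma continuity_point_if_fibre_singleton:
  assumes xX: "x \<in> topspace X" and S: "fibre x \<in> S"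
  shows "x \<in> continuity_points"
  unfolding continuity_points_def
proof (intro CollectI conjI allI impI xX notI)
  fix W assume W: "openin Y W \<and> x \<in> q ` W"
  assume "x \<in> seq_closure X (topspace X - q ` W)"
  then obtain s where s: "range s \<subseteq> topspace X - q ` W" "limitin X s x sequentially"
    unfolding seq_closure_def by blast
  have sX: "range s \<subseteq> topspace X"
    using s(1) by blast
  obtain k where "range s \<subseteq> q ` K k"
    using convergent_sequence_in_some_qK[OF sX s(2)] by blast
  then obtain r y l where r: "strict_mono (r::nat \<Rightarrow> nat)" and l: "limitin Y y l sequentially"
      and yK: "range y \<subseteq> K k" and y: "\<And>n. q (y n) = s (r n)"
    using convergent_subsequence_in_qK[of s k] by blast
  define v where "v n = fibre (s (r n))" for n
  have v: "range v \<subseteq> topspace Ystar"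
    using fibre_in_Ystar(1) sX by (auto simp: v_def)
  have yv: "y n \<in> v n" for n
    using yK y K_subset by (auto simp: v_def fibre_def)
  have miss: "range v \<subseteq> {F \<in> topspace Ystar. F \<inter> W = {}}"
    using v s(1) by (force simp: v_def fibre_def)
  obtain G where G: "G \<in> topspace Ystar" "l \<in> G"
      and GA: "\<And>A. closedin Ystar A \<Longrightarrow> range v \<subseteq> A \<Longrightarrow> G \<in> A"
    using Ystar_cluster_point[OF v yv l] by blast
  have GW: "G \<inter> W = {}"
    using GA[OF closedin_Ystar_miss miss] W by simp
  have "limitin X (\<lambda>n. q (y n)) x sequentially"
    using limitin_subsequence[OF r s(2)] y by (simp add: o_def)
  then have "q l = x"
    using limitin_Hausdorff_unique[OF limitin_q[OF l] _ _ Hausdorff_X] by simp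
  then have "q_star q G = x"
    using q_eq_q_star[OF G(1,2)] by simp
  then have "G \<in> {w \<in> topspace Ystar. q_star q w = q_star q (fibre x)}"
    using G(1) fibre_in_Ystar(2)[OF xX] by simp
  also have "\<dots> = {fibre x}"
    using S by (simp add: singleton_fibres_def)
  finally have "G = fibre x"
    by simp
  moreover have "fibre x \<inter> W \<noteq> {}"
    using W openin_subset by (fastforce simp: fibre_def)
  ultimately show False
    using GW by blast
qed

lemma singleton_fibres_eq: "S = fibre ` continuity_points"
proof
  show "fibre ` continuity_points \<subseteq> S"
    using fibre_singleton_if_continuity_point by blast
  show "S \<subseteq> fibre ` continuity_points"
  proof
    fix z assume z: "z \<in> S"
    then have zY: "z \<in> topspace Ystar" and uniq: "{w \<in> topspace Ystar. q_star q w = q_star q z} = {z}"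
      by (auto simp: singleton_fibres_def)
    have x: "q_star q z \<in> topspace X"
      by (rule q_star_in[OF zY])
    then have "z = fibre (q_star q z)"
      using fibre_in_Ystar[OF x] uniq by blast
    then show "z \<in> fibre ` continuity_points"
      using continuity_point_if_fibre_singleton[OF x] z by auto
  qed
qed

definition V :: "'a set set" where
  "V = Ystar closure_of S"

lemma V_subset: "V \<subseteq> topspace Ystar"
  unfolding V_def by (rule closure_of_subset_topspace)

lemma closedin_V: "closedin Ystar V"
  unfolding V_def by simp

lemma S_subset_V: "S \<subseteq> V"
  unfolding V_def by (rule closure_of_subset) (auto simp: singleton_fibres_def)

lemma V_subset_core:
  assumes v: "v \<in> V"
  shows "v \<subseteq> core"
proof
  fix y assume y: "y \<in> v"
  have vY: "v \<in> topspace Ystar"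
    using v V_subset by blast
  then have yY: "y \<in> topspace Y"
    using y closedin_subset[OF closedin_of_Ystar] by blast
  show "y \<in> core"
    unfolding core_def in_closure_of
  proof (intro conjI allI impI yY)
    fix B assume B: "y \<in> B \<and> openin Y B"
    define N where "N = topspace Ystar \<inter> {F. closedin Y F \<and> F \<inter> B \<noteq> {}}"
    have "openin Ystar N"
      unfolding N_def using B by (intro openin_YstarI openin_fell_hit) simp
    moreover have "v \<in> N"
      unfolding N_def using vY closedin_of_Ystar y B by blast
    ultimately obtain s where s: "s \<in> S" "s \<in> N"
      using v unfolding V_def in_closure_of by blast
    then have "s \<inter> B \<noteq> {}"
      by (simp add: N_def)
    with s(1) show "\<exists>y. y \<in> {y \<in> topspace Y. q y \<in> continuity_points} \<and> y \<in> B"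
      unfolding singleton_fibres_eq by (auto simp: fibre_def)
  qed
qed

lemma core_covered_by_V:
  assumes y: "y \<in> core"
  shows "\<exists>v \<in> V. y \<in> v"
proof -
  obtain s where s: "range s \<subseteq> {z \<in> topspace Y. q z \<in> continuity_points}" "limitin Y s y sequentially"
    using core_sequence[OF y openin_topspace set_mp[OF core_subset y]] by (elim exE conjE)
  have v: "range (\<lambda>n. fibre (q (s n))) \<subseteq> V"
    using s(1) fibre_singleton_if_continuity_point S_subset_V by blast
  have sv: "s n \<in> fibre (q (s n))" for n
    using s(1) by (auto simp: fibre_def)
  obtain G where "y \<in> G"
      and "\<And>A. closedin Ystar A \<Longrightarrow> range (\<lambda>n. fibre (q (s n))) \<subseteq> A \<Longrightarrow> G \<in> A"
    using Ystar_cluster_point[OF subset_trans[OF v V_subset] sv s(2)] by blast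
  then show ?thesis
    using closedin_V v by blast
qed

text \<open>For every \<open>C\<close> the preimage of \<open>C\<close> in \<open>V\<close> is closed iff the preimage in the core is. In one direction,
members of \<open>V\<close> through the points of a convergent sequence cluster at a member through the limit. In
the other, a member of \<open>V\<close> lies over \<open>C\<close> iff it misses the open complement of the preimage in the core.\<close>

lemma quotient_on_V_iff_quotient_on_core:
  "quotient_map (subtopology Ystar V) X (q_star q) \<longleftrightarrow> quotient_map (subtopology Y core) X q"
proof -
  have topV: "topspace (subtopology Ystar V) = V"
    using V_subset by auto
  have topC: "topspace (subtopology Y core) = core"
    using core_subset by auto
  have qv: "q y = q_star q v" if "v \<in> V" "y \<in> v" for v y
    using that V_subset q_eq_q_star by blast
  have ne: "\<exists>y. y \<in> v" if "v \<in> V" for v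
    using that V_subset in_Ystar_iff by blast
  have img: "q_star q ` V = q ` core"
  proof
    show "q_star q ` V \<subseteq> q ` core"
    proof (rule image_subsetI)
      fix v assume v: "v \<in> V"
      then obtain y where y: "y \<in> v"
        using ne by blast
      then have "y \<in> core"
        using V_subset_core[OF v] by blast
      then show "q_star q v \<in> q ` core"
        using qv[OF v y] by (metis imageI)
    qed
    show "q ` core \<subseteq> q_star q ` V"
    proof (rule image_subsetI)
      fix y assume "y \<in> core"
      then obtain v where v: "v \<in> V" "y \<in> v"
        using core_covered_by_V by blast
      then show "q y \<in> q_star q ` V"
        using qv[OF v] by simp
    qed
  qed
  have "closedin Ystar {v \<in> V. q_star q v \<in> C} \<longleftrightarrow> closedin Y {y \<in> core. q y \<in> C}" for C
  proof
    let ?A = "{v \<in> V. q_star q v \<in> C}" and ?B = "{y \<in> core. q y \<in> C}"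
    assume A: "closedin Ystar ?A"
    have "Y closure_of ?B \<subseteq> ?B"
    proof
      fix y assume "y \<in> Y closure_of ?B"
      then obtain s where s: "range s \<subseteq> ?B" "limitin Y s y sequentially"
        unfolding metrizable_closure_eq_seq_closure[OF metrizable] seq_closure_def by blast
      have "\<forall>n. \<exists>v. v \<in> V \<and> s n \<in> v"
        using s(1) core_covered_by_V by blast
      then obtain v where v: "\<And>n. v n \<in> V" "\<And>n. s n \<in> v n"
        by metis
      have "v n \<in> ?A" for n
      proof -
        have "s n \<in> ?B"
          using s(1) by blast
        then show ?thesis
          using v(1)[of n] qv[OF v(1) v(2), of n] by simp
      qed
      then have vA: "range v \<subseteq> ?A"
        by blast
      have vY: "range v \<subseteq> topspace Ystar"
        using v(1) V_subset by blast
      obtain G where yG: "y \<in> G"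
          and GA: "\<And>A. closedin Ystar A \<Longrightarrow> range v \<subseteq> A \<Longrightarrow> G \<in> A"
        using Ystar_cluster_point[OF vY v(2) s(2)] by blast
      have G: "G \<in> ?A"
        by (rule GA[OF A vA])
      then show "y \<in> ?B"
        using V_subset_core[of G] qv[of G y] yG by auto
    qed
    moreover have "?B \<subseteq> topspace Y"
      using core_subset by blast
    ultimately show "closedin Y ?B"
      using closure_of_subset_eq by blast
  next
    let ?A = "{v \<in> V. q_star q v \<in> C}" and ?B = "{y \<in> core. q y \<in> C}"
    assume B: "closedin Y ?B"
    have "?A = V \<inter> {F \<in> topspace Ystar. F \<inter> (topspace Y - ?B) = {}}"
    proof (intro equalityI subsetI)
      fix v assume v: "v \<in> ?A"
      have "v \<subseteq> ?B"
      proof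
        fix y assume "y \<in> v"
        then show "y \<in> ?B"
          using v V_subset_core[of v] qv[of v y] by auto
      qed
      then show "v \<in> V \<inter> {F \<in> topspace Ystar. F \<inter> (topspace Y - ?B) = {}}"
        using v V_subset by blast
    next
      fix v assume v: "v \<in> V \<inter> {F \<in> topspace Ystar. F \<inter> (topspace Y - ?B) = {}}"
      then obtain y where y: "y \<in> v"
        using ne by blast
      then have "y \<in> ?B"
        using v V_subset_core core_subset by blast
      then show "v \<in> ?A"
        using qv[of v y] v y by auto
    qed
    then show "closedin Ystar ?A"
      using B closedin_V closedin_Ystar_miss[of "topspace Y - ?B"] by auto
  qed
  moreover have "closedin (subtopology Ystar V) {v \<in> V. q_star q v \<in> C} \<longleftrightarrow> closedin Ystar {v \<in> V. q_star q v \<in> C}" for C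
    using closedin_closed_subtopology[OF closedin_V] by auto
  moreover have "closedin (subtopology Y core) {y \<in> core. q y \<in> C} \<longleftrightarrow> closedin Y {y \<in> core. q y \<in> C}" for C
    using closedin_closed_subtopology[OF closedin_core] by auto
  ultimately show ?thesis
    unfolding quotient_map_closedin topV topC img by simp
qed

text \<open>A singleton fibre is the only member of \<open>Y\<^sub>*\<close> over its base point, so every closed set that maps onto
\<open>X\<close> contains all of them and hence also their closure \<open>V\<close>.\<close>

lemma irreducible_on_V:
  assumes "q_star q ` V = topspace X"
  shows "irreducible_map (subtopology Ystar V) X (q_star q)"
  unfolding irreducible_map_def
proof (intro conjI notI)
  have topV: "topspace (subtopology Ystar V) = V"
    using V_subset by auto
  show "q_star q ` topspace (subtopology Ystar V) = topspace X"
    unfolding topV by (rule assms)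
  assume "\<exists>W. closedin (subtopology Ystar V) W \<and> W \<noteq> topspace (subtopology Ystar V) \<and> q_star q ` W = topspace X"
  then obtain W where W: "closedin Ystar W" "W \<subseteq> V" "W \<noteq> V" "q_star q ` W = topspace X"
    unfolding topV using closedin_closed_subtopology[OF closedin_V] by blast
  have "S \<subseteq> W"
  proof
    fix z assume z: "z \<in> S"
    then have "q_star q z \<in> q_star q ` W"
      using q_star_in unfolding W(4) singleton_fibres_def by blast
    then obtain w where w: "w \<in> W" "q_star q w = q_star q z"
      by force
    then have "w = z"
      using z closedin_subset[OF W(1)] unfolding singleton_fibres_def by blast
    then show "z \<in> W"
      using w by simp
  qed
  then have "V \<subseteq> W"
    unfolding V_def using W(1) by (rule closure_of_minimal)
  then show False
    using W by blast
qed

end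

theorem theorem5p4:
  fixes Y :: "'a topology" and X :: "'b topology" and q :: "'a \<Rightarrow> 'b"
    and V :: "'a set set"
  assumes "standard_space Y" and "Hausdorff_space X" and "quotient_map Y X q"
  defines "V \<equiv> Y_star Y X q closure_of singleton_fibres (Y_star Y X q) (q_star q)"
  shows "(\<exists>E. sequentially_dense X E \<and> (\<forall>x\<in>E. compact_type_point X x) \<and>
              property_a X E \<and> property_b X E)
     \<longleftrightarrow> (quotient_map (subtopology (Y_star Y X q) V) X (q_star q) \<and>
          irreducible_map (subtopology (Y_star Y X q) V) X (q_star q))"
proof -
  from standard_space_countable_base[OF assms(1)] obtain U :: "nat \<Rightarrow> 'a set" where
    U: "\<forall>i. openin Y (U i) \<and> compactin Y (Y closure_of U i)"
       "\<forall>W y. openin Y W \<and> y \<in> W \<longrightarrow> (\<exists>i. y \<in> U i \<and> Y closure_of U i \<subseteq> W)"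
    by (elim exE conjE)
  interpret sq: standard_quotient Y X q U
  proof
    show "metrizable_space Y"
      using assms(1) by (simp add: standard_space_def)
  qed (use assms(2,3) U in simp_all)
  have V: "V = sq.V"
    by (simp add: V_def sq.V_def)
  show ?thesis
  proof
    assume "\<exists>E. sequentially_dense X E \<and> (\<forall>x\<in>E. compact_type_point X x) \<and> property_a X E \<and> property_b X E"
    then obtain E where E: "sequentially_dense X E" "\<forall>x\<in>E. compact_type_point X x"
        "property_a X E" "property_b X E"
      by blast
    have "quotient_map (subtopology Y sq.core) X q"
      by (rule sq.core_quotient[OF E(1) _ E(3,4)]) (use E(2) in simp)
    then have quot: "quotient_map (subtopology (Y_star Y X q) V) X (q_star q)"
      unfolding V by (simp add: sq.quotient_on_V_iff_quotient_on_core)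
    then have "q_star q ` sq.V = topspace X"
      using quotient_imp_surjective_map[OF quot] sq.V_subset by (simp add: V inf.absorb2)
    then show "quotient_map (subtopology (Y_star Y X q) V) X (q_star q) \<and>
          irreducible_map (subtopology (Y_star Y X q) V) X (q_star q)"
      using quot sq.irreducible_on_V by (simp add: V)
  next
    assume "quotient_map (subtopology (Y_star Y X q) V) X (q_star q) \<and>
          irreducible_map (subtopology (Y_star Y X q) V) X (q_star q)"
    then have quot: "quotient_map (subtopology Y sq.core) X q"
      unfolding V by (simp add: sq.quotient_on_V_iff_quotient_on_core)
    have "q ` sq.core = topspace X"
      using quotient_imp_surjective_map[OF quot] sq.core_subset by (simp add: inf.absorb2)
    then show "\<exists>E. sequentially_dense X E \<and> (\<forall>x\<in>E. compact_type_point X x) \<and> property_a X E \<and> property_b X E"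
      by (intro exI[of _ sq.continuity_points] conjI ballI sq.sequentially_dense_continuity_points
          sq.continuity_point_compact_type sq.property_a_continuity_points
          sq.property_b_continuity_points[OF quot])
  qed
qed

end
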